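(* Consider a sequence of linear models $Y=X\beta+\varepsilon$ with $n\to\infty$, $p=p_n$, where $X\in\mathbb{R}^{n\times p}$ is fixed, $X^\top X$ is invertible, $S=(X^\top X)^{-1}X^\top$ has columns $S_{.j}$, $j=1,\dots,n$, and $Q=I_n-X(X^\top X)^{-1}X^\top$. Let $w_p\in\mathbb{R}^p$ be vectors of unit norm. Assume: (i) $\varepsilon=\Sigma^{1/2}Z$, where $\Sigma$ is diagonal and $Z=(Z_1,\dots,Z_n)^\top$ has independent entries with means zero, variances one, and fourth moments bounded by a constant $C_4$; moreover for all $i$, $Z_i=\psi_i(N_i)$, where $(N_1,\dots,N_n)^\top\sim\mathcal{N}(0,I_n)$ and $\psi_i:\mathbb{R}\to\mathbb{R}$ are twice-differentiable functions with $\|\psi_i'\|_\infty<c_1$ and $\|\psi_i''\|_\infty<c_2$ for some positive constants $c_1,c_2$. (ii) For some positive constants $c,C$: $\lambda_{\min}(Q\odot Q)>c$; $\max_j|w_p^\top S_{.j}|=o\left(n^{-1/4}[\lambda_{\min}(X^\top X)]^{-1/2}\right)$; and $c<\lambda_{\min}(\Sigma)\le\lambda_{\max}(\Sigma)<C$. (iii) $$\frac{\max_{j\in\{1,\dots,n\}}|w_p^\top S\Sigma^{1/2}e_j|^2}{w_p^\top S\Sigma S^\top w_p}\to0.$$ Then, with $\hat\beta=SY$ and $\hat\varepsilon=Y-X\hat\beta$, $$\frac{w_p^\top\hat\beta-w_p^\top\beta}{\sqrt{w_p^\top S\,\mathrm{diag}\left[(Q\odot Q)^{-1}(\hat\varepsilon\odot\hat\varepsilon)\right]S^\top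 w_p}}\Rightarrow\mathcal{N}(0,1).$$
   Context: The constants $C_4,c_1,c_2,c,C$ do not depend on $n,p$. $\odot$ is the Hadamard (entrywise) product; for a vector $v$, $\mathrm{diag}[v]$ is the diagonal matrix with diagonal $v$. $e_j$ is the $j$-th canonical basis vector of $\mathbb{R}^n$. $\lambda_{\min},\lambda_{\max}$ are the smallest and largest eigenvalues. $\|f\|_\infty=\sup_{x\in\mathbb{R}}|f(x)|$. $\Rightarrow$ denotes convergence in distribution as $n\to\infty$. The quantity under the square root may be nonpositive; on that event the ratio is assigned an arbitrary value (e.g. $0$). *)

theory Defs
  imports
    "HOL-Probability.Probability"
    "HOL-Library.Landau_Symbols"
    "Jordan_Normal_Form.Spectral_Radius"
    "Jordan_Normal_Form.Gauss_Jordan_Elimination"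
begin

text \<open>
  The dimensions vary with the sample size, so vectors and matrices are those of
  Jordan_Normal_Form (explicit dimensions, 0-based indices). The bullet below is its
  scalar product, and not the inner product of HOL-Analysis.
\<close>

no_notation inner (infix \<open>\<bullet>\<close> 70)

text \<open>Meaningful for invertible matrices only (\<open>mat_inverse\<close> returns an option).\<close>

definition mat_inv :: "real mat \<Rightarrow> real mat" where
  "mat_inv A = the (mat_inverse A)"

definition hadamard_mat :: "real mat \<Rightarrow> real mat \<Rightarrow> real mat" (infixl \<open>\<odot>\<^sub>m\<close> 70) where
  "A \<odot>\<^sub>m B = Matrix.mat (dim_row A) (dim_col A) (\<lambda>(i, j). A $$ (i, j) * B $$ (i, j))"

definition hadamard_vec :: "real vec \<Rightarrow> real vec \<Rightarrow> real vec" (infixl \<open>\<odot>\<^sub>v\<close> 70) where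
  "u \<odot>\<^sub>v v = Matrix.vec (dim_vec u) (\<lambda>i. vec_index u i * vec_index v i)"

definition diag_of_vec :: "real vec \<Rightarrow> real mat" where
  "diag_of_vec v = mat_diag (dim_vec v) (vec_index v)"

text \<open>
  These collect the real eigenvalues only; they are applied to symmetric matrices of
  positive dimension, whose spectrum is real, finite and nonempty.
\<close>

definition lambda_min :: "real mat \<Rightarrow> real" where
  "lambda_min A = Min (spectrum A)"

definition lambda_max :: "real mat \<Rightarrow> real" where
  "lambda_max A = Max (spectrum A)"

text \<open>
  The square root of a diagonal matrix with nonnegative entries. Taking entrywise
  roots is correct for diagonal matrices only.
\<close>

definition diag_sqrt :: "real mat \<Rightarrow> real mat" where
  "diag_sqrt A = map_mat sqrt A"

definition ols_mat :: "real mat \<Rightarrow> real mat" where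
  "ols_mat X = mat_inv (transpose_mat X * X) * transpose_mat X"

definition resid_mat :: "real mat \<Rightarrow> real mat" where
  "resid_mat X = 1\<^sub>m (dim_row X) - X * mat_inv (transpose_mat X * X) * transpose_mat X"

text \<open>Extended-real valued, so that an unbounded function has norm \<open>\<infinity>\<close>.\<close>

definition sup_norm :: "(real \<Rightarrow> real) \<Rightarrow> ereal" where
  "sup_norm f = (SUP x. ereal \<bar>f x\<bar>)"

definition twice_differentiable :: "(real \<Rightarrow> real) \<Rightarrow> bool" where
  "twice_differentiable f \<longleftrightarrow>
     (\<forall>x. f differentiable (at x)) \<and> (\<forall>x. deriv f differentiable (at x))"

text \<open>\<open>\<N>(0, I\<^sub>n)\<close> on \<open>\<real>\<^sup>n\<close>, the latter represented by functions on \<open>{..<n}\<close>.\<close>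

definition std_normal_vec_distribution :: "nat \<Rightarrow> (nat \<Rightarrow> real) measure" where
  "std_normal_vec_distribution n = (\<Pi>\<^sub>M i\<in>{..<n}. std_normal_distribution)"

definition beta_hat :: "real mat \<Rightarrow> real vec \<Rightarrow> real vec" where
  "beta_hat X Y = ols_mat X *\<^sub>v Y"

definition eps_hat :: "real mat \<Rightarrow> real vec \<Rightarrow> real vec" where
  "eps_hat X Y = Y - X *\<^sub>v beta_hat X Y"

text \<open>The estimated variance of \<open>w\<^sup>T beta_hat\<close>; it may be nonpositive.\<close>

definition var_hat :: "real mat \<Rightarrow> real vec \<Rightarrow> real vec \<Rightarrow> real" where
  "var_hat X w Y =
     (let S = ols_mat X; Q = resid_mat X; e = eps_hat X Y in
       w \<bullet> (S * diag_of_vec (mat_inv (Q \<odot>\<^sub>m Q) *\<^sub>v (e \<odot>\<^sub>v e)) * transpose_mat S *\<^sub>v w))"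

text \<open>The value \<open>r\<close> is the one assigned where the ratio is undefined.\<close>

definition studentized :: "real \<Rightarrow> real mat \<Rightarrow> real vec \<Rightarrow> real vec \<Rightarrow> real vec \<Rightarrow> real" where
  "studentized r X b w Y =
     (if var_hat X w Y > 0 then (w \<bullet> beta_hat X Y - w \<bullet> b) / sqrt (var_hat X w Y) else r)"

end

theory Submission
  imports Defs
begin

text \<open>
  Put \<open>a = S\<^sup>T w\<close>, let \<open>s\<^sub>j\<close> be the square roots of the diagonal entries of \<open>\<Sigma>\<close>, and let
  \<open>V = w\<^sup>T S \<Sigma> S\<^sup>T w = \<Sum> a\<^sub>j\<^sup>2 s\<^sub>j\<^sup>2\<close>. The estimation error is \<open>\<Sum> a\<^sub>j s\<^sub>j Z\<^sub>j\<close>, a sum of independent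
  centred terms of total variance \<open>V\<close>; the hypothesis \<open>lindeberg\<close> says that no term carries a fixed share of
  \<open>V\<close>, so with bounded fourth moments this sum divided by \<open>sqrt V\<close> is asymptotically standard normal
  (\<open>triangular_array_clt\<close>, by characteristic functions). It remains to see that the variance
  estimate divided by \<open>V\<close> tends to 1 in probability; the ratio of the two then has the same limit
  (\<open>weak_conv_self_normalized\<close>).

  The residuals are \<open>Q \<epsilon>\<close> with \<open>Q\<close> an orthogonal projection. Because \<open>Q \<odot> Q\<close> is symmetric, its
  inverse can be moved from the squared residuals onto \<open>a \<odot> a\<close>: with \<open>(Q \<odot> Q) d = a \<odot> a\<close> the
  variance estimate is the quadratic form \<open>\<epsilon>\<^sup>T Q diag[d] Q \<epsilon>\<close> (\<open>var_hat_quadratic_form\<close>). The same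
  equation says that the diagonal of \<open>Q diag[d] Q\<close> is \<open>a \<odot> a\<close>, so the estimate is unbiased for
  \<open>V\<close>. The variance of a quadratic form is at most a constant times the squared Frobenius norm of its
  matrix (\<open>second_moment_quadratic_form\<close>). Projections do not increase that norm, so it is at most
  \<open>\<Sum> d\<^sub>k\<^sup>2\<close>, which the lower bound \<open>c\<close> on the spectrum of \<open>Q \<odot> Q\<close> bounds by
  \<open>\<Sum> a\<^sub>k\<^sup>4 / c\<^sup>2\<close>. Relative to \<open>V\<^sup>2\<close> this is of the order of the ratio in \<open>lindeberg\<close>,
  which tends to 0
  (\<open>variance_ratio_concentrates\<close>).

  The lower bound on the spectrum enters through the variational characterization of the smallest
  eigenvalue (\<open>lambda_min_le_quadratic_form\<close>), which is proved by minimizing over the unit sphere.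
\<close>

section \<open>Quadratic forms of symmetric matrices\<close>

lemma quadratic_nonneg_imp_linear_zero:
  fixes B C :: real
  assumes "\<And>t. 0 \<le> 2 * t * B + t\<^sup>2 * C"
  shows "B = 0"
proof (rule ccontr)
  assume "B \<noteq> 0"
  define k where "k = \<bar>C\<bar> + 1"
  have k: "k > 0" "C \<le> k" by (auto simp: k_def)
  \<comment> \<open>The minimizer for a quadratic coefficient \<open>k > max 0 C\<close>.\<close>
  have "0 \<le> 2 * (- B / k) * B + (- B / k)\<^sup>2 * C" by (rule assms)
  also have "\<dots> \<le> 2 * (- B / k) * B + (- B / k)\<^sup>2 * k"
    using k by (intro add_left_mono mult_left_mono) auto
  also have "\<dots> = - (B\<^sup>2 / k)" using k by (simp add: power2_eq_square)
  finally show False using k \<open>B \<noteq> 0\<close> by (simp add: divide_le_0_iff)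
qed

text \<open>
  The dimension is a parameter here, so the unit sphere of \<open>\<real>\<^sup>n\<close> is taken inside the functions on the
  naturals with the product topology. There it is a closed subset of a cube, which is compact by
  Tychonoff's theorem.
\<close>

lemma compact_sphere_functions:
  fixes n :: nat
  shows "compact {f :: nat \<Rightarrow> real. (\<forall>i\<ge>n. f i = 0) \<and> (\<Sum>i<n. (f i)\<^sup>2) = 1}" (is "compact ?K")
proof -
  have "compactin (product_topology (\<lambda>i. euclidean) UNIV) (PiE UNIV (\<lambda>i::nat. {-1..1::real}))"
    by (subst compactin_PiE) (auto simp: compactin_euclidean_iff)
  then have box: "compact (PiE UNIV (\<lambda>i::nat. {-1..1::real}))"
    by (simp add: euclidean_product_topology compactin_euclidean_iff)
  have "?K = (\<Inter>i\<in>{n..}. (\<lambda>f. f i) -` {0}) \<inter> (\<lambda>f. \<Sum>i<n. (f i)\<^sup>2) -` {1}" by auto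
  also have "closed \<dots>"
    by (intro closed_Int closed_INT ballI closed_vimage closed_singleton continuous_intros
        continuous_on_product_coordinates)
  finally have closed: "closed ?K" .
  have "?K \<subseteq> PiE UNIV (\<lambda>i::nat. {-1..1::real})"
  proof
    fix f assume f: "f \<in> ?K"
    have "\<bar>f i\<bar> \<le> 1" for i
    proof (cases "i < n")
      case True
      then have "(f i)\<^sup>2 \<le> (\<Sum>i<n. (f i)\<^sup>2)" by (intro member_le_sum) auto
      with f have "(f i)\<^sup>2 \<le> 1" by simp
      then show ?thesis by (simp add: abs_square_le_1)
    qed (use f in auto)
    then show "f \<in> PiE UNIV (\<lambda>i::nat. {-1..1::real})" by (auto simp: abs_le_iff)
  qed
  then have "PiE UNIV (\<lambda>i::nat. {-1..1::real}) \<inter> ?K = ?K" by (rule Int_absorb1)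
  with compact_Int_closed[OF box closed] show ?thesis by (simp only:)
qed

text \<open>
  The Rayleigh quotient attains its minimum \<open>\<mu>\<close> on the unit sphere at some \<open>f\<close>. The form
  \<open>g \<mapsto> g\<^sup>T A g - \<mu> g\<^sup>T g\<close> is then nonnegative and vanishes at \<open>f\<close>, so its first variation at \<open>f\<close> is
  zero, which makes \<open>f\<close> an eigenvector for \<open>\<mu>\<close>. In particular the real spectrum is nonempty, which
  the definition of \<open>lambda_min\<close> as a minimum presupposes.
\<close>

lemma lambda_min_le_quadratic_form:
  fixes x :: "nat \<Rightarrow> real"
  assumes A: "A \<in> carrier_mat n n" and n: "0 < n"
    and sym: "\<And>i j. i < n \<Longrightarrow> j < n \<Longrightarrow> A $$ (i, j) = A $$ (j, i)"
  shows "lambda_min A * (\<Sum>i<n. (x i)\<^sup>2) \<le> (\<Sum>i<n. \<Sum>j<n. x i * A $$ (i, j) * x j)"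
proof -
  define bil where "bil f g = (\<Sum>i<n. \<Sum>j<n. f i * A $$ (i, j) * g j)" for f g :: "nat \<Rightarrow> real"
  define sph where "sph = {f :: nat \<Rightarrow> real. (\<forall>i\<ge>n. f i = 0) \<and> (\<Sum>i<n. (f i)\<^sup>2) = 1}"
  have "compact sph" unfolding sph_def by (rule compact_sphere_functions)
  moreover have "(\<lambda>i. of_bool (i = 0)) \<in> sph"
  proof -
    have "(\<Sum>i<n. (of_bool (i = 0))\<^sup>2) = (\<Sum>i<n. if i = 0 then 1 else 0 :: real)"
      by (intro sum.cong) auto
    then show ?thesis using n by (simp add: sph_def)
  qed
  then have "sph \<noteq> {}" by auto
  moreover have "continuous_on sph (\<lambda>f. bil f f)"
    unfolding bil_def
    by (intro continuous_intros continuous_on_subset[OF continuous_on_product_coordinates]) auto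
  ultimately obtain f where f: "f \<in> sph" and min: "\<And>g. g \<in> sph \<Longrightarrow> bil f f \<le> bil g g"
    using continuous_attains_inf[of sph "\<lambda>f. bil f f"] by blast
  define \<mu> where "\<mu> = bil f f"
  have bil_ge: "\<mu> * (\<Sum>i<n. (g i)\<^sup>2) \<le> bil g g" for g
  proof (cases "(\<Sum>i<n. (g i)\<^sup>2) = 0")
    case True
    then have "g i = 0" if "i < n" for i using that by (simp add: sum_nonneg_eq_0_iff)
    then show ?thesis by (simp add: bil_def)
  next
    case False
    define s where "s = sqrt (\<Sum>i<n. (g i)\<^sup>2)"
    have s2: "s\<^sup>2 = (\<Sum>i<n. (g i)\<^sup>2)" by (simp add: s_def sum_nonneg)
    with False have s: "s \<noteq> 0" by auto
    have "(\<lambda>i. if i < n then g i / s else 0) \<in> sph"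
      using s s2[symmetric] by (simp add: sph_def power_divide flip: sum_divide_distrib)
    then have "\<mu> \<le> bil (\<lambda>i. if i < n then g i / s else 0) (\<lambda>i. if i < n then g i / s else 0)"
      unfolding \<mu>_def by (rule min)
    also have "\<dots> = bil g g / s\<^sup>2"
      by (simp add: bil_def sum_divide_distrib power2_eq_square)
    finally have "\<mu> * s\<^sup>2 \<le> bil g g" using s by (simp add: pos_le_divide_eq)
    then show ?thesis by (simp only: s2)
  qed
  define r where "r i = (\<Sum>j<n. A $$ (i, j) * f j) - \<mu> * f i" for i
  have f1: "(\<Sum>i<n. (f i)\<^sup>2) = 1" using f by (simp add: sph_def)
  have bil_sym: "bil f r = bil r f"
    unfolding bil_def by (subst sum.swap, intro sum.cong refl) (auto simp: sym mult_ac)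
  have bil_add_left: "bil (\<lambda>i. u i + t * v i) g = bil u g + t * bil v g" for u v g t
    by (simp add: bil_def sum.distrib sum_distrib_left distrib_right mult.assoc)
  have bil_add_right: "bil g (\<lambda>i. u i + t * v i) = bil g u + t * bil g v" for u v g t
    by (simp add: bil_def sum.distrib sum_distrib_left distrib_left mult.left_commute)
  \<comment> \<open>The first variation in the direction \<open>r = A f - \<mu> f\<close> is \<open>2 |r|\<^sup>2\<close>.\<close>
  have "(\<Sum>i<n. (r i)\<^sup>2) = 0"
  proof (rule quadratic_nonneg_imp_linear_zero)
    fix t
    have "0 \<le> bil (\<lambda>i. f i + t * r i) (\<lambda>i. f i + t * r i) - \<mu> * (\<Sum>i<n. (f i + t * r i)\<^sup>2)"
      using bil_ge by simp
    also have "bil (\<lambda>i. f i + t * r i) (\<lambda>i. f i + t * r i)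
        = bil f f + t * bil f r + t * bil r f + t\<^sup>2 * bil r r"
      by (simp add: bil_add_left bil_add_right power2_eq_square distrib_left)
    also have "(\<Sum>i<n. (f i + t * r i)\<^sup>2)
        = (\<Sum>i<n. (f i)\<^sup>2) + 2 * t * (\<Sum>i<n. r i * f i) + t\<^sup>2 * (\<Sum>i<n. (r i)\<^sup>2)"
      by (simp add: power2_sum sum.distrib sum_distrib_left power_mult_distrib mult_ac)
    also have "bil f f + t * bil f r + t * bil r f + t\<^sup>2 * bil r r
        - \<mu> * ((\<Sum>i<n. (f i)\<^sup>2) + 2 * t * (\<Sum>i<n. r i * f i) + t\<^sup>2 * (\<Sum>i<n. (r i)\<^sup>2))
        = 2 * t * (bil r f - \<mu> * (\<Sum>i<n. r i * f i)) + t\<^sup>2 * (bil r r - \<mu> * (\<Sum>i<n. (r i)\<^sup>2))"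
      unfolding bil_sym f1 \<mu>_def[symmetric] by (simp add: algebra_simps)
    also have "bil r f - \<mu> * (\<Sum>i<n. r i * f i) = (\<Sum>i<n. r i * r i)"
      unfolding bil_def sum_distrib_left sum_subtractf[symmetric]
    proof (rule sum.cong)
      fix i
      have "r i * r i = r i * ((\<Sum>j<n. A $$ (i, j) * f j) - \<mu> * f i)" by (simp only: r_def)
      then show "(\<Sum>j<n. r i * A $$ (i, j) * f j) - \<mu> * (r i * f i) = r i * r i"
        by (simp add: sum_distrib_left right_diff_distrib mult_ac)
    qed simp
    finally show "0 \<le> 2 * t * (\<Sum>i<n. (r i)\<^sup>2) + t\<^sup>2 * (bil r r - \<mu> * (\<Sum>i<n. (r i)\<^sup>2))"
      by (simp add: power2_eq_square)
  qed
  then have r0: "r i = 0" if "i < n" for i using that by (simp add: sum_nonneg_eq_0_iff)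
  have "eigenvector A (vec n f) \<mu>"
    unfolding eigenvector_def
  proof (intro conjI)
    show "vec n f \<in> carrier_vec (dim_row A)" using A by auto
    show "vec n f \<noteq> 0\<^sub>v (dim_row A)"
    proof
      assume "vec n f = 0\<^sub>v (dim_row A)"
      then have "f i = 0" if "i < n" for i
        using A that by (metis carrier_matD(1) index_vec index_zero_vec(1))
      with f1 show False by simp
    qed
    show "A *\<^sub>v vec n f = \<mu> \<cdot>\<^sub>v vec n f"
    proof (rule eq_vecI)
      fix i assume "i < dim_vec (\<mu> \<cdot>\<^sub>v vec n f)"
      then show "(A *\<^sub>v vec n f) $ i = (\<mu> \<cdot>\<^sub>v vec n f) $ i"
        using A r0[of i] by (simp add: r_def scalar_prod_def atLeast0LessThan)
    qed (use A in auto)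
  qed
  then have "\<mu> \<in> spectrum A" by (auto simp: spectrum_def eigenvalue_def)
  then have "lambda_min A \<le> \<mu>"
    unfolding lambda_min_def using card_finite_spectrum(1)[OF A] by simp
  then have "lambda_min A * (\<Sum>i<n. (x i)\<^sup>2) \<le> \<mu> * (\<Sum>i<n. (x i)\<^sup>2)"
    by (intro mult_right_mono sum_nonneg) auto
  also have "\<dots> \<le> bil x x" by (rule bil_ge)
  finally show ?thesis by (simp add: bil_def)
qed

text \<open>
  For an orthogonal projection \<open>q\<close>, \<open>|x|\<^sup>2 - |q x|\<^sup>2 = |x - q x|\<^sup>2\<close>. Applied to the columns of
  \<open>diag[d] q\<close>, this removes the left factor from the Frobenius norm of \<open>q diag[d] q\<close>; the right factor
  is harmless since the rows of a projection have norm at most 1.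
\<close>

lemma
  fixes q :: "nat \<Rightarrow> nat \<Rightarrow> real"
  assumes sym: "\<And>i j. i < n \<Longrightarrow> j < n \<Longrightarrow> q i j = q j i"
    and idem: "\<And>i j. i < n \<Longrightarrow> j < n \<Longrightarrow> (\<Sum>k<n. q i k * q k j) = q i j"
  shows projection_contracts: "(\<Sum>i<n. (\<Sum>k<n. q i k * x k)\<^sup>2) \<le> (\<Sum>k<n. (x k)\<^sup>2)"
    and projection_sandwich_frobenius_le:
      "(\<Sum>i<n. \<Sum>j<n. (\<Sum>k<n. q i k * d k * q k j)\<^sup>2) \<le> (\<Sum>k<n. (d k)\<^sup>2)"
proof -
  show contr: "(\<Sum>i<n. (\<Sum>k<n. q i k * x k)\<^sup>2) \<le> (\<Sum>k<n. (x k)\<^sup>2)" for x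
  proof -
    define y where "y i = (\<Sum>k<n. q i k * x k)" for i
    have qy: "(\<Sum>i<n. q i k * y i) = y k" if "k < n" for k
    proof -
      have "(\<Sum>i<n. q i k * y i) = (\<Sum>i<n. \<Sum>l<n. q k i * q i l * x l)"
        using that sym by (intro sum.cong) (auto simp: y_def sum_distrib_left mult.assoc)
      also have "\<dots> = (\<Sum>l<n. \<Sum>i<n. q k i * q i l * x l)" by (rule sum.swap)
      also have "\<dots> = y k"
        unfolding y_def using that idem by (intro sum.cong) (auto simp flip: sum_distrib_right)
      finally show ?thesis .
    qed
    have "(\<Sum>i<n. (y i)\<^sup>2) = (\<Sum>i<n. \<Sum>k<n. y i * (q i k * x k))"
      by (simp add: power2_eq_square sum_distrib_left[symmetric] flip: y_def)
    also have "\<dots> = (\<Sum>k<n. \<Sum>i<n. y i * (q i k * x k))" by (rule sum.swap)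
    also have "\<dots> = (\<Sum>k<n. x k * (\<Sum>i<n. q i k * y i))"
      by (simp add: sum_distrib_left mult_ac)
    also have "\<dots> = (\<Sum>k<n. x k * y k)" using qy by simp
    finally have "(\<Sum>i<n. (x i - y i)\<^sup>2) = (\<Sum>i<n. (x i)\<^sup>2) - (\<Sum>i<n. (y i)\<^sup>2)"
      by (simp add: power2_diff sum.distrib sum_subtractf mult.assoc flip: sum_distrib_left)
    moreover have "0 \<le> (\<Sum>i<n. (x i - y i)\<^sup>2)" by (simp add: sum_nonneg)
    ultimately show ?thesis by (simp add: y_def)
  qed
  have row_norm: "(\<Sum>j<n. (q k j)\<^sup>2) \<le> 1" if k: "k < n" for k
  proof -
    have "(\<Sum>j<n. (q k j)\<^sup>2) = (\<Sum>j<n. q k j * q j k)"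
      using k sym by (intro sum.cong) (auto simp: power2_eq_square)
    then have eq: "(\<Sum>j<n. (q k j)\<^sup>2) = q k k" using idem k by simp
    moreover have "(q k k)\<^sup>2 \<le> (\<Sum>j<n. (q k j)\<^sup>2)" using k by (intro member_le_sum) auto
    ultimately have "q k k * q k k \<le> q k k * 1" "0 \<le> q k k"
      by (auto simp: power2_eq_square eq[symmetric] intro: sum_nonneg)
    then show ?thesis using eq by (metis mult_le_cancel_left_pos order_le_less zero_le_one)
  qed
  have "(\<Sum>i<n. \<Sum>j<n. (\<Sum>k<n. q i k * d k * q k j)\<^sup>2)
      = (\<Sum>j<n. \<Sum>i<n. (\<Sum>k<n. q i k * (d k * q k j))\<^sup>2)"
    by (subst sum.swap) (simp add: mult.assoc)
  also have "\<dots> \<le> (\<Sum>j<n. \<Sum>k<n. (d k * q k j)\<^sup>2)" by (intro sum_mono contr)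
  also have "\<dots> = (\<Sum>k<n. (d k)\<^sup>2 * (\<Sum>j<n. (q k j)\<^sup>2))"
    by (subst sum.swap) (simp add: power_mult_distrib sum_distrib_left)
  also have "\<dots> \<le> (\<Sum>k<n. (d k)\<^sup>2 * 1)" using row_norm by (intro sum_mono mult_left_mono) auto
  finally show "(\<Sum>i<n. \<Sum>j<n. (\<Sum>k<n. q i k * d k * q k j)\<^sup>2) \<le> (\<Sum>k<n. (d k)\<^sup>2)" by simp
qed

text \<open>
  Pair \<open>B d = u\<close> with \<open>d\<close> and use Young's inequality \<open>d\<^sub>i u\<^sub>i \<le> (c d\<^sub>i\<^sup>2 + u\<^sub>i\<^sup>2 / c) / 2\<close> to absorb
  half of the coercive term.
\<close>

lemma solution_norm_le:
  fixes B :: "nat \<Rightarrow> nat \<Rightarrow> real"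
  assumes c: "0 < c"
    and coercive: "c * (\<Sum>i<n. (d i)\<^sup>2) \<le> (\<Sum>i<n. \<Sum>j<n. d i * B i j * d j)"
    and solves: "\<And>i. i < n \<Longrightarrow> (\<Sum>j<n. B i j * d j) = u i"
  shows "c\<^sup>2 * (\<Sum>i<n. (d i)\<^sup>2) \<le> (\<Sum>i<n. (u i)\<^sup>2)"
proof -
  have "(\<Sum>i<n. \<Sum>j<n. d i * B i j * d j) = (\<Sum>i<n. d i * u i)"
    by (intro sum.cong refl) (simp add: solves[symmetric] sum_distrib_left mult.assoc)
  also have "\<dots> \<le> (\<Sum>i<n. (c * (d i)\<^sup>2 + (u i)\<^sup>2 / c) / 2)"
  proof (rule sum_mono)
    fix i
    have "0 \<le> (c * d i - u i)\<^sup>2 / c" using c by simp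
    also have "\<dots> = c * (d i)\<^sup>2 + (u i)\<^sup>2 / c - 2 * (d i * u i)"
      using c by (simp add: power2_eq_square field_simps)
    finally show "d i * u i \<le> (c * (d i)\<^sup>2 + (u i)\<^sup>2 / c) / 2" by simp
  qed
  also have "\<dots> = (c * (\<Sum>i<n. (d i)\<^sup>2) + (\<Sum>i<n. (u i)\<^sup>2) / c) / 2"
    by (simp add: sum.distrib sum_distrib_left flip: sum_divide_distrib)
  finally have "c * (\<Sum>i<n. (d i)\<^sup>2) \<le> (\<Sum>i<n. (u i)\<^sup>2) / c" using coercive by simp
  then show ?thesis using c by (simp add: field_simps power2_eq_square)
qed

section \<open>Inverses and diagonal matrices\<close>

lemma diagonal_entry_in_spectrum:
  fixes A :: "real mat"
  assumes A: "A \<in> carrier_mat n n" and diag: "diagonal_mat A" and i: "i < n"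
  shows "A $$ (i, i) \<in> spectrum A"
proof -
  have "A *\<^sub>v unit_vec n i = A $$ (i, i) \<cdot>\<^sub>v unit_vec n i"
  proof (rule eq_vecI)
    fix j assume "j < dim_vec (A $$ (i, i) \<cdot>\<^sub>v unit_vec n i)"
    then have j: "j < n" by simp
    have "(A *\<^sub>v unit_vec n i) $ j = row A j \<bullet> unit_vec n i" using A j by simp
    also have "\<dots> = A $$ (j, i)" using A i j by (subst scalar_prod_right_unit) auto
    also have "\<dots> = (A $$ (i, i) \<cdot>\<^sub>v unit_vec n i) $ j"
      using A i j diag by (cases "j = i") (auto simp: diagonal_mat_def)
    finally show "(A *\<^sub>v unit_vec n i) $ j = (A $$ (i, i) \<cdot>\<^sub>v unit_vec n i) $ j" .
  qed (use A in auto)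
  moreover have "unit_vec n i \<noteq> (0\<^sub>v n :: real vec)"
    using i by (rule unit_vec_nonzero)
  ultimately have "eigenvector A (unit_vec n i) (A $$ (i, i))"
    using A by (auto simp: eigenvector_def)
  then show ?thesis by (auto simp: spectrum_def eigenvalue_def)
qed

lemma mat_inv_of_trivial_kernel:
  assumes A: "A \<in> carrier_mat n n"
    and ker: "\<And>x. x \<in> carrier_vec n \<Longrightarrow> A *\<^sub>v x = 0\<^sub>v n \<Longrightarrow> x = 0\<^sub>v n"
  shows "mat_inv A \<in> carrier_mat n n" "A * mat_inv A = 1\<^sub>m n" "mat_inv A * A = 1\<^sub>m n"
proof -
  have "det A \<noteq> 0" using ker det_0_iff_vec_prod_zero[OF A] by auto
  then have "A \<in> Units (ring_mat TYPE(real) n undefined)" by (rule det_non_zero_imp_unit[OF A])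
  then obtain B where "mat_inverse A = Some B"
    using mat_inverse(1)[OF A] by fastforce
  then show "mat_inv A \<in> carrier_mat n n" "A * mat_inv A = 1\<^sub>m n" "mat_inv A * A = 1\<^sub>m n"
    using mat_inverse(2)[OF A] by (auto simp: mat_inv_def)
qed

lemma mat_inv_of_invertible:
  assumes A: "A \<in> carrier_mat n n" and inv: "invertible_mat A"
  shows "mat_inv A \<in> carrier_mat n n" "A * mat_inv A = 1\<^sub>m n" "mat_inv A * A = 1\<^sub>m n"
proof -
  obtain B where AB: "A * B = 1\<^sub>m n" and BA: "B * A = 1\<^sub>m (dim_row B)"
    using inv A by (auto simp: invertible_mat_def inverts_mat_def)
  have "dim_col B = n" using AB by (metis index_mult_mat(3) index_one_mat(3))
  moreover have "dim_row B = n" using BA A by (metis carrier_matD(2) index_mult_mat(3) index_one_mat(3))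
  ultimately have B: "B \<in> carrier_mat n n" by auto
  have "x = 0\<^sub>v n" if x: "x \<in> carrier_vec n" and "A *\<^sub>v x = 0\<^sub>v n" for x
  proof -
    have "x = (B * A) *\<^sub>v x" using BA B x by simp
    also have "\<dots> = B *\<^sub>v (A *\<^sub>v x)" using A B x by simp
    finally show ?thesis using that B by auto
  qed
  from mat_inv_of_trivial_kernel[OF A this]
  show "mat_inv A \<in> carrier_mat n n" "A * mat_inv A = 1\<^sub>m n" "mat_inv A * A = 1\<^sub>m n" by auto
qed

lemma diagonal_mult_vec:
  fixes D :: "'a :: semiring_0 mat"
  assumes "D \<in> carrier_mat n n" "diagonal_mat D" "u \<in> carrier_vec n" "i < n"
  shows "(D *\<^sub>v u) $ i = D $$ (i, i) * u $ i"
proof -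
  have "(D *\<^sub>v u) $ i = (\<Sum>j\<in>{0..<n}. D $$ (i, j) * u $ j)"
    using assms by (simp add: scalar_prod_def)
  also have "\<dots> = (\<Sum>j\<in>{i}. D $$ (i, j) * u $ j)"
    using assms by (intro sum.mono_neutral_right) (auto simp: diagonal_mat_def)
  finally show ?thesis by simp
qed

lemma scalar_prod_mult_vec:
  fixes S :: "real mat"
  assumes S: "S \<in> carrier_mat p n" and w: "w \<in> carrier_vec p" and u: "u \<in> carrier_vec n"
  shows "w \<bullet> (S *\<^sub>v u) = (\<Sum>j<n. (w \<bullet> col S j) * u $ j)"
proof -
  have "w \<bullet> (S *\<^sub>v u) = (transpose_mat S *\<^sub>v w) \<bullet> u"
    using transpose_vec_mult_scalar[OF S u w] by simp
  also have "\<dots> = (\<Sum>j<n. (col S j \<bullet> w) * u $ j)"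
    using S w u by (simp add: scalar_prod_def atLeast0LessThan)
  also have "\<dots> = (\<Sum>j<n. (w \<bullet> col S j) * u $ j)"
    using S w by (intro sum.cong refl) (simp add: comm_scalar_prod[of _ p])
  finally show ?thesis .
qed

lemma scalar_prod_sandwich_diagonal:
  fixes S :: "real mat"
  assumes S: "S \<in> carrier_mat p n" and w: "w \<in> carrier_vec p"
    and D: "D \<in> carrier_mat n n" "diagonal_mat D"
  shows "w \<bullet> (S * D * transpose_mat S *\<^sub>v w) = (\<Sum>j<n. (w \<bullet> col S j)\<^sup>2 * D $$ (j, j))"
proof -
  have ST: "transpose_mat S \<in> carrier_mat n p" using S by simp
  let ?v = "transpose_mat S *\<^sub>v w"
  have v: "?v \<in> carrier_vec n" using ST w by (rule mult_mat_vec_carrier)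
  have "S * D * transpose_mat S *\<^sub>v w = S * D *\<^sub>v ?v"
    by (rule assoc_mult_mat_vec[OF mult_carrier_mat[OF S D(1)] ST w])
  also have "\<dots> = S *\<^sub>v (D *\<^sub>v ?v)" by (rule assoc_mult_mat_vec[OF S D(1) v])
  finally have "w \<bullet> (S * D * transpose_mat S *\<^sub>v w) = (\<Sum>j<n. (w \<bullet> col S j) * (D *\<^sub>v ?v) $ j)"
    using scalar_prod_mult_vec[OF S w mult_mat_vec_carrier[OF D(1) v]] by simp
  also have "\<dots> = (\<Sum>j<n. (w \<bullet> col S j)\<^sup>2 * D $$ (j, j))"
  proof (rule sum.cong)
    fix j assume "j \<in> {..<n}"
    then have j: "j < n" by simp
    have "(D *\<^sub>v ?v) $ j = D $$ (j, j) * ?v $ j" by (rule diagonal_mult_vec[OF D v j])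
    also have "?v $ j = w \<bullet> col S j"
      using S w j by (simp add: comm_scalar_prod[of _ p])
    finally show "(w \<bullet> col S j) * (D *\<^sub>v ?v) $ j = (w \<bullet> col S j)\<^sup>2 * D $$ (j, j)"
      by (simp add: power2_eq_square)
  qed simp
  finally show ?thesis .
qed

lemma scalar_prod_diagonal_unit:
  fixes S :: "real mat"
  assumes S: "S \<in> carrier_mat p n" and w: "w \<in> carrier_vec p"
    and D: "D \<in> carrier_mat n n" "diagonal_mat D" and j: "j < n"
  shows "w \<bullet> (S * D *\<^sub>v unit_vec n j) = (w \<bullet> col S j) * D $$ (j, j)"
proof -
  have "S * D *\<^sub>v unit_vec n j = S *\<^sub>v (D *\<^sub>v unit_vec n j)"
    by (rule assoc_mult_mat_vec[OF S D(1) unit_vec_carrier])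
  then have "w \<bullet> (S * D *\<^sub>v unit_vec n j) = (\<Sum>i<n. (w \<bullet> col S i) * (D *\<^sub>v unit_vec n j) $ i)"
    using scalar_prod_mult_vec[OF S w mult_mat_vec_carrier[OF D(1) unit_vec_carrier]] by simp
  also have "\<dots> = (\<Sum>i<n. if i = j then (w \<bullet> col S j) * D $$ (j, j) else 0)"
    using D j by (intro sum.cong refl) (simp add: diagonal_mult_vec del: index_mult_mat_vec)
  also have "\<dots> = (w \<bullet> col S j) * D $$ (j, j)" using j by simp
  finally show ?thesis .
qed

section \<open>Least squares\<close>

lemma least_squares_matrices:
  assumes X: "X \<in> carrier_mat n p" and inv: "invertible_mat (transpose_mat X * X)"
  defines "S \<equiv> ols_mat X" and "Q \<equiv> resid_mat X"
  shows "S \<in> carrier_mat p n" "Q \<in> carrier_mat n n" "S * X = 1\<^sub>m p" "Q = 1\<^sub>m n - X * S"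
    "transpose_mat Q = Q" "Q * Q = Q"
proof -
  define G where "G = transpose_mat X * X"
  define H where "H = mat_inv G"
  have XT: "transpose_mat X \<in> carrier_mat p n" using X by simp
  have G: "G \<in> carrier_mat p p" using X by (simp add: G_def)
  have H: "H \<in> carrier_mat p p" "G * H = 1\<^sub>m p" "H * G = 1\<^sub>m p"
    using mat_inv_of_invertible[OF G] inv by (auto simp: G_def H_def)
  have S_eq: "S = H * transpose_mat X" by (simp add: S_def ols_mat_def H_def G_def)
  show S: "S \<in> carrier_mat p n" using H XT by (simp add: S_eq)
  show SX: "S * X = 1\<^sub>m p" using H XT X by (simp add: S_eq G_def)
  show Q_eq: "Q = 1\<^sub>m n - X * S"
    using X H XT by (simp add: Q_def resid_mat_def S_eq H_def G_def)
  have XS: "X * S \<in> carrier_mat n n" using X S by simp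
  show Q: "Q \<in> carrier_mat n n" unfolding Q_eq using XS by (rule minus_carrier_mat)
  have GT: "transpose_mat G = G" using X by (simp add: G_def transpose_mult[of _ p n _ p])
  have "transpose_mat H = transpose_mat H * (G * H)" using H by simp
  also have "\<dots> = (transpose_mat H * transpose_mat G) * H" using H G by (simp add: GT)
  also have "transpose_mat H * transpose_mat G = transpose_mat (G * H)"
    by (rule transpose_mult[OF G H(1), symmetric])
  finally have HT: "transpose_mat H = H" using H by simp
  have "transpose_mat (X * S) = transpose_mat S * transpose_mat X"
    using X S by (simp add: transpose_mult[of _ n p _ n])
  also have "transpose_mat S = X * H"
    unfolding S_eq using H XT X HT by (simp add: transpose_mult[of _ p p _ n])
  finally have XST: "transpose_mat (X * S) = X * S" using X H XT by (simp add: S_eq)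
  show "transpose_mat Q = Q"
    unfolding Q_eq using XS XST by (simp add: transpose_minus[of _ n n])
  have "X * S * (X * S) = X * (S * (X * S))" by (rule assoc_mult_mat[OF X S XS])
  also have "S * (X * S) = S * X * S" by (rule assoc_mult_mat[OF S X S, symmetric])
  also have "\<dots> = S" using S by (simp add: SX)
  finally have idem: "X * S * (X * S) = X * S" .
  have "Q * (X * S) = 0\<^sub>m n n"
    unfolding Q_eq minus_mult_distrib_mat[OF one_carrier_mat XS XS] idem left_mult_one_mat[OF XS]
    by (rule minus_r_inv_mat[OF XS])
  then have "Q * (1\<^sub>m n - X * S) = Q"
    by (subst mult_minus_distrib_mat[OF Q one_carrier_mat XS]) (use Q in auto)
  then show "Q * Q = Q" by (simp only: Q_eq[symmetric])
qed

context
  fixes X :: "real mat" and n p :: nat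
  assumes X: "X \<in> carrier_mat n p" and inv: "invertible_mat (transpose_mat X * X)"
begin

lemmas LS = least_squares_matrices[OF X inv]

lemma beta_hat_model:
  assumes \<beta>: "\<beta> \<in> carrier_vec p" and \<epsilon>: "\<epsilon> \<in> carrier_vec n"
  shows "beta_hat X (X *\<^sub>v \<beta> + \<epsilon>) = \<beta> + ols_mat X *\<^sub>v \<epsilon>"
proof -
  have X\<beta>: "X *\<^sub>v \<beta> \<in> carrier_vec n" using X \<beta> by simp
  have "beta_hat X (X *\<^sub>v \<beta> + \<epsilon>) = ols_mat X *\<^sub>v (X *\<^sub>v \<beta>) + ols_mat X *\<^sub>v \<epsilon>"
    unfolding beta_hat_def by (rule mult_add_distrib_mat_vec[OF LS(1) X\<beta> \<epsilon>])
  also have "ols_mat X *\<^sub>v (X *\<^sub>v \<beta>) = \<beta>"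
    using assoc_mult_mat_vec[OF LS(1) X \<beta>] \<beta> by (simp add: LS(3))
  finally show ?thesis .
qed

lemma estimation_error_model:
  assumes w: "w \<in> carrier_vec p" and \<beta>: "\<beta> \<in> carrier_vec p" and \<epsilon>: "\<epsilon> \<in> carrier_vec n"
  shows "w \<bullet> beta_hat X (X *\<^sub>v \<beta> + \<epsilon>) - w \<bullet> \<beta> = (\<Sum>j<n. (w \<bullet> col (ols_mat X) j) * \<epsilon> $ j)"
  unfolding beta_hat_model[OF \<beta> \<epsilon>]
  using scalar_prod_add_distrib[OF w \<beta> mult_mat_vec_carrier[OF LS(1) \<epsilon>]]
    scalar_prod_mult_vec[OF LS(1) w \<epsilon>] by simp

lemma eps_hat_model:
  assumes \<beta>: "\<beta> \<in> carrier_vec p" and \<epsilon>: "\<epsilon> \<in> carrier_vec n"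
  shows "eps_hat X (X *\<^sub>v \<beta> + \<epsilon>) = resid_mat X *\<^sub>v \<epsilon>"
proof -
  have coef: "ols_mat X *\<^sub>v \<epsilon> \<in> carrier_vec p" using LS(1) \<epsilon> by simp
  have X\<beta>: "X *\<^sub>v \<beta> \<in> carrier_vec n" and XS\<epsilon>: "X *\<^sub>v (ols_mat X *\<^sub>v \<epsilon>) \<in> carrier_vec n"
    using X \<beta> coef by simp_all
  have "resid_mat X *\<^sub>v \<epsilon> = \<epsilon> - X *\<^sub>v (ols_mat X *\<^sub>v \<epsilon>)"
    unfolding LS(4) minus_mult_distrib_mat_vec[OF one_carrier_mat mult_carrier_mat[OF X LS(1)] \<epsilon>]
    using assoc_mult_mat_vec[OF X LS(1) \<epsilon>] \<epsilon> by simp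
  moreover have "eps_hat X (X *\<^sub>v \<beta> + \<epsilon>) = X *\<^sub>v \<beta> + \<epsilon> - (X *\<^sub>v \<beta> + X *\<^sub>v (ols_mat X *\<^sub>v \<epsilon>))"
    unfolding eps_hat_def beta_hat_model[OF assms] mult_add_distrib_mat_vec[OF X \<beta> coef] by simp
  moreover have "x + z - (x + y) = z - y"
    if "x \<in> carrier_vec n" "y \<in> carrier_vec n" "z \<in> carrier_vec n" for x y z :: "real vec"
    using that by (intro eq_vecI) auto
  then have "X *\<^sub>v \<beta> + \<epsilon> - (X *\<^sub>v \<beta> + X *\<^sub>v (ols_mat X *\<^sub>v \<epsilon>)) = \<epsilon> - X *\<^sub>v (ols_mat X *\<^sub>v \<epsilon>)"
    using X\<beta> XS\<epsilon> \<epsilon> by blast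
  ultimately show ?thesis by simp
qed

text \<open>
  Since \<open>S X = 1\<close>, \<open>w\<close> can be recovered from \<open>S\<^sup>T w\<close> as \<open>X\<^sup>T S\<^sup>T w\<close>. Hence the variance of the
  estimation error does not degenerate, and the ratio in the Lindeberg condition is a genuine quotient.
\<close>

lemma ols_weights_nonzero:
  assumes w: "w \<in> carrier_vec p" and "w \<bullet> w \<noteq> 0"
  shows "0 < (\<Sum>j<n. (w \<bullet> col (ols_mat X) j)\<^sup>2)"
proof (rule ccontr)
  assume "\<not> 0 < (\<Sum>j<n. (w \<bullet> col (ols_mat X) j)\<^sup>2)"
  then have "(\<Sum>j<n. (w \<bullet> col (ols_mat X) j)\<^sup>2) = 0"
    by (simp add: order_antisym sum_nonneg not_less)
  then have zero: "w \<bullet> col (ols_mat X) j = 0" if "j < n" for j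
    using that by (simp add: sum_nonneg_eq_0_iff)
  have "w = ols_mat X *\<^sub>v (X *\<^sub>v w)" using assoc_mult_mat_vec[OF LS(1) X w] w by (simp add: LS(3))
  then have "w \<bullet> w = w \<bullet> (ols_mat X *\<^sub>v (X *\<^sub>v w))" by simp
  also have "\<dots> = 0"
    using scalar_prod_mult_vec[OF LS(1) w mult_mat_vec_carrier[OF X w]] zero by simp
  finally show False using assms by simp
qed

lemma resid_projection:
  assumes "i < n" "j < n"
  shows "resid_mat X $$ (i, j) = resid_mat X $$ (j, i)" "(\<Sum>k<n. resid_mat X $$ (i, k) * resid_mat X $$ (k, j)) = resid_mat X $$ (i, j)"
proof -
  show "resid_mat X $$ (i, j) = resid_mat X $$ (j, i)"
    using assms LS(2,5) by (metis carrier_matD index_transpose_mat(1))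
  have "(resid_mat X * resid_mat X) $$ (i, j) = (\<Sum>k<n. resid_mat X $$ (i, k) * resid_mat X $$ (k, j))"
    using assms LS(2) by (simp add: scalar_prod_def atLeast0LessThan)
  then show "(\<Sum>k<n. resid_mat X $$ (i, k) * resid_mat X $$ (k, j)) = resid_mat X $$ (i, j)" by (simp add: LS(6))
qed

lemma QQ_coercive:
  fixes x :: "nat \<Rightarrow> real"
  assumes n: "0 < n"
  shows "lambda_min (resid_mat X \<odot>\<^sub>m resid_mat X) * (\<Sum>i<n. (x i)\<^sup>2) \<le> (\<Sum>i<n. \<Sum>j<n. x i * (resid_mat X $$ (i, j))\<^sup>2 * x j)"
proof -
  have carrier: "resid_mat X \<odot>\<^sub>m resid_mat X \<in> carrier_mat n n" using LS(2) by (simp add: hadamard_mat_def)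
  have entry: "(resid_mat X \<odot>\<^sub>m resid_mat X) $$ (i, j) = (resid_mat X $$ (i, j))\<^sup>2" if "i < n" "j < n" for i j
    using LS(2) that by (simp add: hadamard_mat_def power2_eq_square)
  have "lambda_min (resid_mat X \<odot>\<^sub>m resid_mat X) * (\<Sum>i<n. (x i)\<^sup>2)
      \<le> (\<Sum>i<n. \<Sum>j<n. x i * (resid_mat X \<odot>\<^sub>m resid_mat X) $$ (i, j) * x j)"
    using resid_projection(1) by (intro lambda_min_le_quadratic_form[OF carrier n]) (simp add: entry)
  then show ?thesis by (simp add: entry)
qed

text \<open>
  The vector \<open>d\<close> is \<open>(Q \<odot> Q)\<^sup>-\<^sup>1 (a \<odot> a)\<close> for \<open>a = S\<^sup>T w\<close>. With \<open>e\<close> the residuals and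
  \<open>v = (Q \<odot> Q)\<^sup>-\<^sup>1 (e \<odot> e)\<close>, symmetry of \<open>Q \<odot> Q\<close> gives
  \<open>\<Sum> a\<^sub>i\<^sup>2 v\<^sub>i = ((Q \<odot> Q) d)\<^sup>T v = d\<^sup>T (Q \<odot> Q) v = \<Sum> d\<^sub>k e\<^sub>k\<^sup>2\<close>, in which no inverse is left.
\<close>

lemma var_hat_quadratic_form:
  assumes w: "w \<in> carrier_vec p" and n: "0 < n" and pos: "0 < lambda_min (resid_mat X \<odot>\<^sub>m resid_mat X)"
  obtains d :: "nat \<Rightarrow> real" where
    "\<And>i. i < n \<Longrightarrow> (\<Sum>k<n. (resid_mat X $$ (i, k))\<^sup>2 * d k) = (w \<bullet> col (ols_mat X) i)\<^sup>2"
    "\<And>\<beta> \<epsilon>. \<beta> \<in> carrier_vec p \<Longrightarrow> \<epsilon> \<in> carrier_vec n \<Longrightarrow>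
      var_hat X w (X *\<^sub>v \<beta> + \<epsilon>) = (\<Sum>k<n. d k * (\<Sum>j<n. resid_mat X $$ (k, j) * \<epsilon> $ j)\<^sup>2)"
proof -
  define B where "B = resid_mat X \<odot>\<^sub>m resid_mat X"
  have B: "B \<in> carrier_mat n n" using LS(2) by (simp add: B_def hadamard_mat_def)
  have B_entry: "B $$ (i, j) = (resid_mat X $$ (i, j))\<^sup>2" if "i < n" "j < n" for i j
    using LS(2) that by (simp add: B_def hadamard_mat_def power2_eq_square)
  have B_vec: "(B *\<^sub>v x) $ i = (\<Sum>k<n. (resid_mat X $$ (i, k))\<^sup>2 * x $ k)" if "x \<in> carrier_vec n" "i < n" for x i
    using B that by (simp add: scalar_prod_def atLeast0LessThan B_entry)
  have "x = 0\<^sub>v n" if x: "x \<in> carrier_vec n" and Bx: "B *\<^sub>v x = 0\<^sub>v n" for x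
  proof -
    have "(\<Sum>i<n. \<Sum>j<n. x $ i * (resid_mat X $$ (i, j))\<^sup>2 * x $ j) = (\<Sum>i<n. x $ i * (B *\<^sub>v x) $ i)"
      using x by (intro sum.cong refl) (simp add: B_vec sum_distrib_left mult.assoc del: index_mult_mat_vec)
    also have "\<dots> = 0" by (simp add: Bx)
    finally have "lambda_min (resid_mat X \<odot>\<^sub>m resid_mat X) * (\<Sum>i<n. (x $ i)\<^sup>2) \<le> 0"
      using QQ_coercive[OF n, of "\<lambda>i. x $ i"] by simp
    with pos have "(\<Sum>i<n. (x $ i)\<^sup>2) \<le> 0" by (simp add: mult_le_0_iff)
    then have "(\<Sum>i<n. (x $ i)\<^sup>2) = 0" by (intro order_antisym sum_nonneg) auto
    then have "x $ i = 0" if "i < n" for i using that by (simp add: sum_nonneg_eq_0_iff)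
    then show ?thesis using x by (intro eq_vecI) auto
  qed
  note B_inv = mat_inv_of_trivial_kernel[OF B this]
  have B_solve: "B *\<^sub>v (mat_inv B *\<^sub>v u) = u" if "u \<in> carrier_vec n" for u
    using assoc_mult_mat_vec[OF B B_inv(1) that] that by (simp add: B_inv(2))
  define u where "u = vec n (\<lambda>i. (w \<bullet> col (ols_mat X) i)\<^sup>2)"
  define dv where "dv = mat_inv B *\<^sub>v u"
  have u: "u \<in> carrier_vec n" by (simp add: u_def)
  have dv: "dv \<in> carrier_vec n" using B_inv(1) u by (simp add: dv_def)
  have Bdv: "(\<Sum>k<n. (resid_mat X $$ (i, k))\<^sup>2 * dv $ k) = (w \<bullet> col (ols_mat X) i)\<^sup>2" if "i < n" for i
    using B_vec[OF dv that] B_solve[OF u] that by (simp add: dv_def u_def)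
  show ?thesis
  proof (rule that[of "\<lambda>k. dv $ k"])
    fix \<beta> \<epsilon> :: "real vec"
    assume \<beta>: "\<beta> \<in> carrier_vec p" and \<epsilon>: "\<epsilon> \<in> carrier_vec n"
    define e where "e = resid_mat X *\<^sub>v \<epsilon>"
    have e: "e \<in> carrier_vec n" using LS(2) \<epsilon> by (simp add: e_def)
    have e_entry: "e $ k = (\<Sum>j<n. resid_mat X $$ (k, j) * \<epsilon> $ j)" if "k < n" for k
      using that LS(2) \<epsilon> by (simp add: e_def scalar_prod_def atLeast0LessThan)
    define v where "v = mat_inv B *\<^sub>v (e \<odot>\<^sub>v e)"
    have ee: "e \<odot>\<^sub>v e \<in> carrier_vec n" using e by (auto simp: hadamard_vec_def)
    have v: "v \<in> carrier_vec n" using B_inv(1) ee by (simp add: v_def)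
    have Bv: "(\<Sum>k<n. (resid_mat X $$ (i, k))\<^sup>2 * v $ k) = (e $ i)\<^sup>2" if "i < n" for i
      using B_vec[OF v that] B_solve[OF ee] that e
      by (simp add: v_def hadamard_vec_def power2_eq_square)
    have "var_hat X w (X *\<^sub>v \<beta> + \<epsilon>) = w \<bullet> (ols_mat X * diag_of_vec v * transpose_mat (ols_mat X) *\<^sub>v w)"
      by (simp add: var_hat_def Let_def eps_hat_model[OF \<beta> \<epsilon>] v_def e_def B_def)
    also have "\<dots> = (\<Sum>i<n. (w \<bullet> col (ols_mat X) i)\<^sup>2 * diag_of_vec v $$ (i, i))"
      using v by (intro scalar_prod_sandwich_diagonal[OF LS(1) w])
        (auto simp: diag_of_vec_def mat_diag_def diagonal_mat_def)
    also have "\<dots> = (\<Sum>i<n. (w \<bullet> col (ols_mat X) i)\<^sup>2 * v $ i)"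
      using v by (intro sum.cong) (auto simp: diag_of_vec_def mat_diag_def)
    also have "\<dots> = (\<Sum>i<n. \<Sum>k<n. (resid_mat X $$ (i, k))\<^sup>2 * dv $ k * v $ i)"
      by (intro sum.cong refl) (simp add: Bdv[symmetric] sum_distrib_right)
    also have "\<dots> = (\<Sum>k<n. \<Sum>i<n. (resid_mat X $$ (i, k))\<^sup>2 * dv $ k * v $ i)" by (rule sum.swap)
    also have "\<dots> = (\<Sum>k<n. dv $ k * (\<Sum>i<n. (resid_mat X $$ (k, i))\<^sup>2 * v $ i))"
      using resid_projection(1) by (intro sum.cong refl) (auto simp: sum_distrib_left mult_ac intro!: sum.cong)
    also have "\<dots> = (\<Sum>k<n. dv $ k * (\<Sum>j<n. resid_mat X $$ (k, j) * \<epsilon> $ j)\<^sup>2)"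
      by (intro sum.cong refl) (simp add: Bv e_entry)
    finally show "var_hat X w (X *\<^sub>v \<beta> + \<epsilon>) = (\<Sum>k<n. dv $ k * (\<Sum>j<n. resid_mat X $$ (k, j) * \<epsilon> $ j)\<^sup>2)" .
  qed (rule Bdv)
qed

end

section \<open>Moments of quadratic forms in independent variables\<close>

context prob_space
begin

lemma integrable_mult4:
  fixes U V W X :: "'a \<Rightarrow> real"
  assumes [measurable]: "U \<in> borel_measurable M" "V \<in> borel_measurable M"
      "W \<in> borel_measurable M" "X \<in> borel_measurable M"
    and int: "integrable M (\<lambda>\<omega>. U \<omega> ^ 4)" "integrable M (\<lambda>\<omega>. V \<omega> ^ 4)"
      "integrable M (\<lambda>\<omega>. W \<omega> ^ 4)" "integrable M (\<lambda>\<omega>. X \<omega> ^ 4)"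
  shows "integrable M (\<lambda>\<omega>. U \<omega> * V \<omega> * W \<omega> * X \<omega>)"
proof (rule Bochner_Integration.integrable_bound)
  show "integrable M (\<lambda>\<omega>. U \<omega> ^ 4 + V \<omega> ^ 4 + W \<omega> ^ 4 + X \<omega> ^ 4)"
    using int by (intro Bochner_Integration.integrable_add)
  show "AE \<omega> in M. norm (U \<omega> * V \<omega> * W \<omega> * X \<omega>) \<le> norm (U \<omega> ^ 4 + V \<omega> ^ 4 + W \<omega> ^ 4 + X \<omega> ^ 4)"
  proof (rule AE_I2)
    fix \<omega>
    have prod2: "\<bar>s * t\<bar> \<le> (s\<^sup>2 + t\<^sup>2) / 2" for s t :: real
    proof -
      have "0 \<le> (\<bar>s\<bar> - \<bar>t\<bar>)\<^sup>2" by simp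
      then show ?thesis by (simp add: power2_diff abs_mult power2_abs)
    qed
    have sq: "(s * t)\<^sup>2 \<le> (s ^ 4 + t ^ 4) / 2" for s t :: real
      using prod2[of "s\<^sup>2" "t\<^sup>2"] by (simp add: power_mult_distrib flip: power_mult)
    have "\<bar>(U \<omega> * V \<omega>) * (W \<omega> * X \<omega>)\<bar> \<le> ((U \<omega> * V \<omega>)\<^sup>2 + (W \<omega> * X \<omega>)\<^sup>2) / 2"
      by (rule prod2)
    also have "\<dots> \<le> (U \<omega> ^ 4 + V \<omega> ^ 4 + W \<omega> ^ 4 + X \<omega> ^ 4) / 4"
      using sq[of "U \<omega>" "V \<omega>"] sq[of "W \<omega>" "X \<omega>"] by simp
    also have "\<dots> \<le> U \<omega> ^ 4 + V \<omega> ^ 4 + W \<omega> ^ 4 + X \<omega> ^ 4"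
      by simp
    finally show "norm (U \<omega> * V \<omega> * W \<omega> * X \<omega>) \<le> norm (U \<omega> ^ 4 + V \<omega> ^ 4 + W \<omega> ^ 4 + X \<omega> ^ 4)"
      by (simp add: mult.assoc)
  qed
qed measurable

lemma
  fixes X :: "'a \<Rightarrow> real"
  assumes [measurable]: "X \<in> borel_measurable M" and int4: "integrable M (\<lambda>\<omega>. X \<omega> ^ 4)"
  shows integrable_of_4: "integrable M X"
    and integrable_square_of_4: "integrable M (\<lambda>\<omega>. (X \<omega>)\<^sup>2)"
    and integrable_cube_of_4: "integrable M (\<lambda>\<omega>. \<bar>X \<omega>\<bar> ^ 3)"
  using integrable_mult4[of "\<lambda>_. 1" "\<lambda>_. 1" "\<lambda>_. 1" X]
    integrable_mult4[of "\<lambda>_. 1" "\<lambda>_. 1" X X]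
    integrable_mult4[of "\<lambda>_. 1" "\<lambda>\<omega>. \<bar>X \<omega>\<bar>" "\<lambda>\<omega>. \<bar>X \<omega>\<bar>" "\<lambda>\<omega>. \<bar>X \<omega>\<bar>"] int4
  by (simp_all add: power2_eq_square power3_eq_cube)

lemma expectation_mult_indep_split:
  fixes Z :: "'i \<Rightarrow> 'a \<Rightarrow> real" and f :: "real \<Rightarrow> real" and g :: "('i \<Rightarrow> real) \<Rightarrow> real"
  assumes ind: "indep_vars (\<lambda>_. borel) Z I" and l: "l \<in> I" "l \<notin> J" and J: "J \<subseteq> I"
    and f: "f \<in> borel_measurable borel"
    and g: "g \<in> borel_measurable (PiM J (\<lambda>_. borel))"
    and int_f: "integrable M (\<lambda>\<omega>. f (Z l \<omega>))"
    and int_g: "integrable M (\<lambda>\<omega>. g (\<lambda>i\<in>J. Z i \<omega>))"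
  shows "expectation (\<lambda>\<omega>. f (Z l \<omega>) * g (\<lambda>i\<in>J. Z i \<omega>))
    = expectation (\<lambda>\<omega>. f (Z l \<omega>)) * expectation (\<lambda>\<omega>. g (\<lambda>i\<in>J. Z i \<omega>))"
proof -
  have "indep_var (PiM {l} (\<lambda>_. borel)) (\<lambda>\<omega>. \<lambda>i\<in>{l}. Z i \<omega>)
      (PiM J (\<lambda>_. borel)) (\<lambda>\<omega>. \<lambda>i\<in>J. Z i \<omega>)"
    using l J by (intro indep_var_restrict[OF ind]) auto
  moreover have "(\<lambda>x. f (x l)) \<in> borel_measurable (PiM {l} (\<lambda>_. borel))"
    using f by measurable
  ultimately have "indep_var borel ((\<lambda>x. f (x l)) \<circ> (\<lambda>\<omega>. \<lambda>i\<in>{l}. Z i \<omega>))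
      borel (g \<circ> (\<lambda>\<omega>. \<lambda>i\<in>J. Z i \<omega>))"
    using g by (rule indep_var_compose)
  then have "indep_var borel (\<lambda>\<omega>. f (Z l \<omega>)) borel (\<lambda>\<omega>. g (\<lambda>i\<in>J. Z i \<omega>))"
    by (simp add: comp_def)
  from indep_var_lebesgue_integral[OF this int_f int_g] show ?thesis .
qed

text \<open>
  The form minus the trace of its matrix is a linear combination of the centred products
  \<open>Z\<^sub>i Z\<^sub>j - E[Z\<^sub>i Z\<^sub>j]\<close>. Two of these are uncorrelated unless they belong to the same unordered pair:
  either some index occurs exactly once among the four, and the expectation factors through a mean
  that is 0, or both are squares of independent variables. So only the diagonal terms and their
  transposes survive in the second moment, whence the factor 2 for a matrix that need not be
  symmetric.
\<close>

lemma second_moment_quadratic_form: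
  fixes Z :: "'i \<Rightarrow> 'a \<Rightarrow> real" and H :: "'i \<Rightarrow> 'i \<Rightarrow> real"
  assumes fin: "finite I" and ind: "indep_vars (\<lambda>_. borel) Z I"
    and int4: "\<And>i. i \<in> I \<Longrightarrow> integrable M (\<lambda>\<omega>. Z i \<omega> ^ 4)"
    and mean: "\<And>i. i \<in> I \<Longrightarrow> expectation (Z i) = 0"
    and second: "\<And>i. i \<in> I \<Longrightarrow> expectation (\<lambda>\<omega>. (Z i \<omega>)\<^sup>2) = 1"
    and fourth: "\<And>i. i \<in> I \<Longrightarrow> expectation (\<lambda>\<omega>. Z i \<omega> ^ 4) \<le> K"
  shows "integrable M (\<lambda>\<omega>. ((\<Sum>i\<in>I. \<Sum>j\<in>I. H i j * (Z i \<omega> * Z j \<omega>)) - (\<Sum>i\<in>I. H i i))\<^sup>2)" (is ?int)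
    and "expectation (\<lambda>\<omega>. ((\<Sum>i\<in>I. \<Sum>j\<in>I. H i j * (Z i \<omega> * Z j \<omega>)) - (\<Sum>i\<in>I. H i i))\<^sup>2)
      \<le> 2 * K * (\<Sum>i\<in>I. \<Sum>j\<in>I. (H i j)\<^sup>2)" (is ?bound)
proof -
  have rv[measurable]: "Z i \<in> borel_measurable M" if "i \<in> I" for i
    using ind that unfolding indep_vars_def2 by auto
  have int_mult4: "integrable M (\<lambda>\<omega>. Z i \<omega> * Z j \<omega> * Z k \<omega> * Z l \<omega>)"
    if "i \<in> I" "j \<in> I" "k \<in> I" "l \<in> I" for i j k l
    using that int4 by (intro integrable_mult4) auto
  have int_mult3: "integrable M (\<lambda>\<omega>. Z i \<omega> * Z j \<omega> * Z k \<omega>)"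
    if "i \<in> I" "j \<in> I" "k \<in> I" for i j k
    using that int4 integrable_mult4[of "\<lambda>_. 1" "Z i" "Z j" "Z k"] by auto
  have int_mult2: "integrable M (\<lambda>\<omega>. Z i \<omega> * Z j \<omega>)" if "i \<in> I" "j \<in> I" for i j
    using that int4 integrable_mult4[of "\<lambda>_. 1" "\<lambda>_. 1" "Z i" "Z j"] by auto
  have lone: "expectation (\<lambda>\<omega>. Z l \<omega> * (Z i \<omega> * Z j \<omega> * Z k \<omega>)) = 0"
    if "i \<in> I" "j \<in> I" "k \<in> I" "l \<in> I" "l \<notin> {i, j, k}" for i j k l
  proof -
    have "expectation (\<lambda>\<omega>. Z l \<omega> * (Z i \<omega> * Z j \<omega> * Z k \<omega>))
        = expectation (Z l) * expectation (\<lambda>\<omega>. Z i \<omega> * Z j \<omega> * Z k \<omega>)"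
      using expectation_mult_indep_split[OF ind, of l "{i, j, k}" "\<lambda>x. x" "\<lambda>x. x i * x j * x k"]
        that int_mult3 integrable_of_4[OF rv int4, of l] by simp
    then show ?thesis using mean that by simp
  qed
  have lone1: "expectation (\<lambda>\<omega>. Z i \<omega> * Z j \<omega> * (Z k \<omega> * Z l \<omega>)) = 0"
    if "i \<in> I" "j \<in> I" "k \<in> I" "l \<in> I" "i \<notin> {j, k, l}" for i j k l
    using lone[of j k l i] that by (simp add: ac_simps)
  have lone2: "expectation (\<lambda>\<omega>. Z i \<omega> * Z j \<omega> * (Z k \<omega> * Z l \<omega>)) = 0"
    if "i \<in> I" "j \<in> I" "k \<in> I" "l \<in> I" "k \<notin> {i, j, l}" for i j k l
    using lone[of i j l k] that by (simp add: ac_simps)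
  have pair: "expectation (\<lambda>\<omega>. Z i \<omega> * Z j \<omega>) = of_bool (i = j)" if "i \<in> I" "j \<in> I" for i j
  proof (cases "i = j")
    case False
    have "expectation (\<lambda>\<omega>. Z i \<omega> * Z j \<omega>) = expectation (Z i) * expectation (Z j)"
      using expectation_mult_indep_split[OF ind, of i "{j}" "\<lambda>x. x" "\<lambda>x. x j"]
        that False integrable_of_4[OF rv int4] by simp
    then show ?thesis using False mean that by simp
  qed (use second that in \<open>simp add: power2_eq_square\<close>)
  have squares: "expectation (\<lambda>\<omega>. Z i \<omega> * Z i \<omega> * (Z k \<omega> * Z k \<omega>)) = 1"
    if "i \<in> I" "k \<in> I" "i \<noteq> k" for i k
    using expectation_mult_indep_split[OF ind, of i "{k}" "\<lambda>x. x * x" "\<lambda>x. x k * x k"]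
      that int_mult2 pair by simp
  define \<xi> where "\<xi> p \<omega> = Z (fst p) \<omega> * Z (snd p) \<omega> - of_bool (fst p = snd p)" for p \<omega>
  have expand: "\<xi> (i, j) \<omega> * \<xi> (k, l) \<omega> = Z i \<omega> * Z j \<omega> * (Z k \<omega> * Z l \<omega>)
      - of_bool (k = l) * (Z i \<omega> * Z j \<omega>) - of_bool (i = j) * (Z k \<omega> * Z l \<omega>)
      + of_bool (i = j) * of_bool (k = l)" for i j k l \<omega>
    by (simp add: \<xi>_def algebra_simps)
  have int_\<xi>: "integrable M (\<lambda>\<omega>. \<xi> p \<omega> * \<xi> q \<omega>)" if "p \<in> I \<times> I" "q \<in> I \<times> I" for p q
  proof -
    obtain i j k l where "p = (i, j)" "q = (k, l)" by fastforce
    then show ?thesis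
      using that int_mult4[of i j k l] int_mult2[of i j] int_mult2[of k l]
      by (simp only: expand) (auto simp: mult.assoc)
  qed
  have E_\<xi>: "expectation (\<lambda>\<omega>. \<xi> (i, j) \<omega> * \<xi> (k, l) \<omega>)
      = expectation (\<lambda>\<omega>. Z i \<omega> * Z j \<omega> * (Z k \<omega> * Z l \<omega>)) - of_bool (i = j) * of_bool (k = l)"
    if "i \<in> I" "j \<in> I" "k \<in> I" "l \<in> I" for i j k l
    using that int_mult4[of i j k l] int_mult2[of i j] int_mult2[of k l] pair
    by (simp only: expand) (simp add: mult.assoc prob_space)
  have orth: "expectation (\<lambda>\<omega>. \<xi> (i, j) \<omega> * \<xi> (k, l) \<omega>) = 0"
    if "i \<in> I" "j \<in> I" "k \<in> I" "l \<in> I" "(k, l) \<noteq> (i, j)" "(k, l) \<noteq> (j, i)" for i j k l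
  proof -
    note distinct = that(5,6)
    consider "i = j" "k = l" "i \<noteq> k" | "i = j" "k \<noteq> l" | "i \<noteq> j" "k = l"
      | "i \<noteq> j" "k \<noteq> l" "k \<notin> {i, j}" | "i \<noteq> j" "k \<noteq> l" "l \<notin> {i, j}"
      using distinct by blast
    then show ?thesis
    proof cases
      case 1
      then show ?thesis using that squares by (simp add: E_\<xi>)
    next
      case 2
      then have "k \<notin> {i, j, l} \<or> l \<notin> {i, j, k}" by auto
      then show ?thesis using that 2 lone2[of i j k l] lone2[of i j l k]
        by (auto simp: E_\<xi> mult.commute[of "Z l _"])
    next
      case 3
      then have "i \<notin> {j, k, l} \<or> j \<notin> {i, k, l}" by auto
      then show ?thesis using that 3 lone1[of i j k l] lone1[of j i k l]
        by (auto simp: E_\<xi> mult.commute[of "Z j _"])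
    next
      case 4
      then show ?thesis using that lone2[of i j k l] by (simp add: E_\<xi>)
    next
      case 5
      then show ?thesis using that lone2[of i j l k] by (simp add: E_\<xi> mult.commute[of "Z l _"])
    qed
  qed
  have diag: "expectation (\<lambda>\<omega>. \<xi> (i, j) \<omega> * \<xi> (i, j) \<omega>) \<in> {0..K}" if "i \<in> I" "j \<in> I" for i j
  proof -
    have "expectation (\<lambda>\<omega>. Z i \<omega> * Z j \<omega> * (Z i \<omega> * Z j \<omega>))
        \<le> expectation (\<lambda>\<omega>. (Z i \<omega> ^ 4 + Z j \<omega> ^ 4) / 2)"
    proof (rule integral_mono)
      show "integrable M (\<lambda>\<omega>. Z i \<omega> * Z j \<omega> * (Z i \<omega> * Z j \<omega>))"
        using int_mult4[of i j i j] that by (simp add: mult.assoc)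
      show "Z i \<omega> * Z j \<omega> * (Z i \<omega> * Z j \<omega>) \<le> (Z i \<omega> ^ 4 + Z j \<omega> ^ 4) / 2" for \<omega>
      proof -
        have "0 \<le> ((Z i \<omega>)\<^sup>2 - (Z j \<omega>)\<^sup>2)\<^sup>2" by simp
        then show ?thesis by (simp add: power2_eq_square power4_eq_xxxx algebra_simps)
      qed
    qed (use that int4 in auto)
    also have "\<dots> \<le> K" using that int4 fourth[of i] fourth[of j] by simp
    finally have "expectation (\<lambda>\<omega>. \<xi> (i, j) \<omega> * \<xi> (i, j) \<omega>) \<le> K"
      using that by (auto simp: E_\<xi>)
    then show ?thesis by (simp add: integral_nonneg_AE)
  qed
  define h where "h p = H (fst p) (snd p)" for p
  have form: "(\<Sum>i\<in>I. \<Sum>j\<in>I. H i j * (Z i \<omega> * Z j \<omega>)) - (\<Sum>i\<in>I. H i i) = (\<Sum>p\<in>I \<times> I. h p * \<xi> p \<omega>)" for \<omega>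
  proof -
    have "(\<Sum>i\<in>I. H i i) = (\<Sum>i\<in>I. \<Sum>j\<in>I. H i j * of_bool (i = j))"
    proof (rule sum.cong)
      fix i assume "i \<in> I"
      then have "(\<Sum>j\<in>I. H i j * of_bool (i = j)) = (\<Sum>j\<in>I. if j = i then H i i else 0)"
        by (intro sum.cong) auto
      with \<open>i \<in> I\<close> fin show "H i i = (\<Sum>j\<in>I. H i j * of_bool (i = j))" by simp
    qed simp
    then show ?thesis
      by (simp add: sum.cartesian_product[symmetric] h_def \<xi>_def right_diff_distrib
          sum_subtractf case_prod_beta flip: sum.cartesian_product)
        (simp add: sum.cartesian_product case_prod_beta)
  qed
  have square: "(\<Sum>p\<in>I \<times> I. h p * \<xi> p \<omega>)\<^sup>2
      = (\<Sum>p\<in>I \<times> I. \<Sum>q\<in>I \<times> I. h p * h q * (\<xi> p \<omega> * \<xi> q \<omega>))" for \<omega>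
    by (simp add: power2_eq_square sum_product ac_simps)
  show ?int
    unfolding form square using int_\<xi> by (intro Bochner_Integration.integrable_sum integrable_mult_right) auto
  have "expectation (\<lambda>\<omega>. (\<Sum>p\<in>I \<times> I. h p * \<xi> p \<omega>)\<^sup>2)
      = (\<Sum>p\<in>I \<times> I. \<Sum>q\<in>I \<times> I. h p * h q * expectation (\<lambda>\<omega>. \<xi> p \<omega> * \<xi> q \<omega>))"
    unfolding square using int_\<xi> by (simp add: Bochner_Integration.integral_sum)
  also have "\<dots> \<le> (\<Sum>p\<in>I \<times> I. K * ((3 * (h p)\<^sup>2 + (h (prod.swap p))\<^sup>2) / 2))"
  proof (rule sum_mono)
    fix p assume p: "p \<in> I \<times> I"
    obtain i j where ij: "p = (i, j)" by fastforce
    let ?E = "expectation (\<lambda>\<omega>. \<xi> p \<omega> * \<xi> p \<omega>)"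
    have E: "0 \<le> ?E" "?E \<le> K" using diag p ij by auto
    have "(\<Sum>q\<in>I \<times> I. h p * h q * expectation (\<lambda>\<omega>. \<xi> p \<omega> * \<xi> q \<omega>))
        = (\<Sum>q\<in>{p, prod.swap p}. h p * h q * expectation (\<lambda>\<omega>. \<xi> p \<omega> * \<xi> q \<omega>))"
    proof (rule sum.mono_neutral_right)
      show "\<forall>q\<in>I \<times> I - {p, prod.swap p}. h p * h q * expectation (\<lambda>\<omega>. \<xi> p \<omega> * \<xi> q \<omega>) = 0"
        using orth p ij by fastforce
    qed (use fin p in auto)
    also have "\<dots> = (\<Sum>q\<in>{p, prod.swap p}. h p * h q * ?E)"
    proof -
      have "\<xi> (prod.swap p) = \<xi> p" by (auto simp: \<xi>_def fun_eq_iff mult.commute)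
      then show ?thesis by (intro sum.cong) auto
    qed
    also have "\<dots> \<le> ((3 * (h p)\<^sup>2 + (h (prod.swap p))\<^sup>2) / 2) * ?E"
    proof (cases "prod.swap p = p")
      case True
      then have "(\<Sum>q\<in>{p, prod.swap p}. h p * h q * ?E) = (h p)\<^sup>2 * ?E"
        by (simp add: power2_eq_square)
      also have "\<dots> \<le> ((3 * (h p)\<^sup>2 + (h (prod.swap p))\<^sup>2) / 2) * ?E"
        using E True by (intro mult_right_mono) auto
      finally show ?thesis .
    next
      case False
      have "0 \<le> (h p - h (prod.swap p))\<^sup>2" by simp
      then have "(h p)\<^sup>2 + h p * h (prod.swap p) \<le> (3 * (h p)\<^sup>2 + (h (prod.swap p))\<^sup>2) / 2"
        by (simp add: power2_diff)
      then have "((h p)\<^sup>2 + h p * h (prod.swap p)) * ?E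
          \<le> ((3 * (h p)\<^sup>2 + (h (prod.swap p))\<^sup>2) / 2) * ?E"
        using E(1) by (rule mult_right_mono)
      moreover have "(\<Sum>q\<in>{p, prod.swap p}. h p * h q * ?E) = ((h p)\<^sup>2 + h p * h (prod.swap p)) * ?E"
        using False by (subst sum.insert) (auto simp: power2_eq_square distrib_right)
      ultimately show ?thesis by simp
    qed
    also have "\<dots> \<le> ((3 * (h p)\<^sup>2 + (h (prod.swap p))\<^sup>2) / 2) * K"
      using E by (intro mult_left_mono) auto
    finally show "(\<Sum>q\<in>I \<times> I. h p * h q * expectation (\<lambda>\<omega>. \<xi> p \<omega> * \<xi> q \<omega>))
        \<le> K * ((3 * (h p)\<^sup>2 + (h (prod.swap p))\<^sup>2) / 2)" by (simp add: mult.commute)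
  qed
  also have "\<dots> = 2 * K * (\<Sum>i\<in>I. \<Sum>j\<in>I. (H i j)\<^sup>2)"
  proof -
    have "(\<Sum>p\<in>I \<times> I. (h p)\<^sup>2) = (\<Sum>i\<in>I. \<Sum>j\<in>I. (H i j)\<^sup>2)"
      by (simp add: sum.cartesian_product h_def case_prod_beta)
    moreover have "(\<Sum>p\<in>I \<times> I. (h (prod.swap p))\<^sup>2) = (\<Sum>j\<in>I. \<Sum>i\<in>I. (H i j)\<^sup>2)"
      by (simp add: sum.cartesian_product h_def case_prod_beta)
    moreover have "\<dots> = (\<Sum>i\<in>I. \<Sum>j\<in>I. (H i j)\<^sup>2)" by (rule sum.swap)
    moreover have "(\<Sum>p\<in>I \<times> I. K * ((3 * (h p)\<^sup>2 + (h (prod.swap p))\<^sup>2) / 2))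
        = K * ((3 * (\<Sum>p\<in>I \<times> I. (h p)\<^sup>2) + (\<Sum>p\<in>I \<times> I. (h (prod.swap p))\<^sup>2)) / 2)"
      by (simp only: sum_distrib_left[symmetric] sum_divide_distrib[symmetric] sum.distrib)
    ultimately show ?thesis by simp
  qed
  finally show ?bound unfolding form .
qed

end

section \<open>A central limit theorem for triangular arrays\<close>

lemma exp_minus_approx:
  fixes y :: real
  assumes "0 \<le> y"
  shows "\<bar>exp (- y) - (1 - y)\<bar> \<le> y\<^sup>2 / 2"
proof -
  have "1 + y + y\<^sup>2 / 2 \<le> exp y"
    using assms by (rule exp_lower_Taylor_quadratic)
  moreover have "0 \<le> (1 - y)\<^sup>2 + 1" by (rule add_nonneg_nonneg) auto
  then have "0 \<le> 1 - y + y\<^sup>2 / 2" by (simp add: power2_eq_square algebra_simps)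
  ultimately have "(1 + y + y\<^sup>2 / 2) * (1 - y + y\<^sup>2 / 2) \<le> exp y * (1 - y + y\<^sup>2 / 2)"
    by (rule mult_right_mono)
  \<comment> \<open>The Taylor polynomials of \<open>exp y\<close> and \<open>exp (- y)\<close> multiply to at least 1, which turns the lower bound for the former into an upper bound for \<open>exp (- y)\<close>.\<close>
  moreover have "(1 + y + y\<^sup>2 / 2) * (1 - y + y\<^sup>2 / 2) = 1 + (y\<^sup>2)\<^sup>2 / 4"
    by (simp add: power2_eq_square algebra_simps)
  ultimately have "1 \<le> exp y * (1 - y + y\<^sup>2 / 2)"
    by (smt (verit) zero_le_power2 divide_nonneg_nonneg)
  then have "exp (- y) \<le> 1 - y + y\<^sup>2 / 2"
    by (simp add: exp_minus divide_simps mult.commute)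
  moreover have "1 - y \<le> exp (- y)" using exp_ge_add_one_self[of "- y"] by simp
  ultimately show ?thesis by (simp add: abs_if)
qed

text \<open>
  Both characteristic functions agree with \<open>1 - (t b)\<^sup>2 / 2\<close> to second order. The third absolute moment
  in the remainder is bounded by \<open>(E[X\<^sup>2] + E[X\<^sup>4]) / 2\<close>.
\<close>

lemma (in prob_space) char_scaled_approx_gaussian:
  fixes X :: "'a \<Rightarrow> real" and b t :: real
  assumes X[measurable]: "X \<in> borel_measurable M"
    and int4: "integrable M (\<lambda>\<omega>. X \<omega> ^ 4)" and mean: "expectation X = 0"
    and second: "expectation (\<lambda>\<omega>. (X \<omega>)\<^sup>2) = 1" and fourth: "expectation (\<lambda>\<omega>. X \<omega> ^ 4) \<le> K"
  shows "cmod (char (distr M borel (\<lambda>\<omega>. b * X \<omega>)) t - exp (- (t * b)\<^sup>2 / 2))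
    \<le> \<bar>t * b\<bar> ^ 3 * (1 + K) / 12 + (t * b) ^ 4 / 8"
proof -
  note [simp] = integrable_of_4[OF X int4] integrable_square_of_4[OF X int4]
    integrable_cube_of_4[OF X int4]
  let ?s = "t * b"
  have scale: "char (distr M borel (\<lambda>\<omega>. b * X \<omega>)) t = char (distr M borel X) ?s"
    unfolding char_def by (subst (1 2) integral_distr) (auto simp: ac_simps)
  have "\<bar>x\<bar> ^ 3 \<le> (x\<^sup>2 + x ^ 4) / 2" for x :: real
  proof -
    have "0 \<le> (\<bar>x\<bar> * (1 - \<bar>x\<bar>))\<^sup>2" by simp
    also have "\<dots> = x\<^sup>2 + x ^ 4 - 2 * \<bar>x\<bar> ^ 3"
      by (cases "0 \<le> x") (simp_all add: power2_eq_square power3_eq_cube power4_eq_xxxx algebra_simps)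
    finally show ?thesis by simp
  qed
  then have "expectation (\<lambda>\<omega>. \<bar>X \<omega>\<bar> ^ 3) \<le> expectation (\<lambda>\<omega>. ((X \<omega>)\<^sup>2 + X \<omega> ^ 4) / 2)"
    using int4 by (intro integral_mono) auto
  also have "\<dots> \<le> (1 + K) / 2"
    using int4 fourth second by simp
  finally have third: "expectation (\<lambda>\<omega>. \<bar>X \<omega>\<bar> ^ 3) \<le> (1 + K) / 2" .
  have "cmod (char (distr M borel X) ?s - (1 - ?s\<^sup>2 * 1 / 2))
      \<le> (?s\<^sup>2 / 6) * expectation (\<lambda>\<omega>. min (6 * (X \<omega>)\<^sup>2) (\<bar>?s\<bar> * \<bar>X \<omega>\<bar> ^ 3))"
    using mean second by (intro char_approx3') auto
  also have "\<dots> \<le> (?s\<^sup>2 / 6) * expectation (\<lambda>\<omega>. \<bar>?s\<bar> * \<bar>X \<omega>\<bar> ^ 3)"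
    by (intro mult_left_mono integral_mono integrable_min) auto
  also have "\<dots> = (?s\<^sup>2 / 6) * (\<bar>?s\<bar> * expectation (\<lambda>\<omega>. \<bar>X \<omega>\<bar> ^ 3))"
    by simp
  also have "\<dots> \<le> (?s\<^sup>2 / 6) * (\<bar>?s\<bar> * ((1 + K) / 2))"
    using third by (intro mult_left_mono) auto
  also have "\<dots> = \<bar>?s\<bar> ^ 3 * (1 + K) / 12"
    by (simp add: power3_eq_cube power2_eq_square)
  finally have 1: "cmod (char (distr M borel X) ?s - (1 - ?s\<^sup>2 / 2)) \<le> \<bar>?s\<bar> ^ 3 * (1 + K) / 12"
    by simp
  have "\<bar>exp (- (?s\<^sup>2 / 2)) - (1 - ?s\<^sup>2 / 2)\<bar> \<le> (?s\<^sup>2 / 2)\<^sup>2 / 2"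
    by (rule exp_minus_approx) simp
  also have "\<dots> = ?s ^ 4 / 8" by (simp add: power_divide flip: power_mult)
  finally have "norm (complex_of_real (exp (- (?s\<^sup>2 / 2)) - (1 - ?s\<^sup>2 / 2))) \<le> ?s ^ 4 / 8"
    by (simp only: norm_of_real)
  then have 2: "cmod ((1 - ?s\<^sup>2 / 2) - complex_of_real (exp (- ?s\<^sup>2 / 2))) \<le> ?s ^ 4 / 8"
    by (subst norm_minus_commute) simp
  have "cmod (char (distr M borel X) ?s - exp (- ?s\<^sup>2 / 2))
      \<le> cmod (char (distr M borel X) ?s - (1 - ?s\<^sup>2 / 2))
        + cmod ((1 - ?s\<^sup>2 / 2) - complex_of_real (exp (- ?s\<^sup>2 / 2)))"
    by (rule order_trans[OF _ norm_triangle_ineq]) simp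
  with 1 2 show ?thesis unfolding scale by simp
qed

text \<open>
  Lyapunov's theorem for weighted sums of variables of mean 0 and variance 1. The characteristic
  function of the sum and the Gaussian one are products over the same index set, with factors of norm
  at most 1, so their distance is at most the sum of the distances of the factors. These are of third
  order in the weights \<open>b\<^sub>i\<close>, and \<open>\<Sum> |b\<^sub>i|\<^sup>3 \<le> \<delta> \<Sum> b\<^sub>i\<^sup>2 = \<delta>\<close>.
\<close>

theorem triangular_array_clt:
  fixes M :: "nat \<Rightarrow> 'a measure" and Z :: "nat \<Rightarrow> 'i \<Rightarrow> 'a \<Rightarrow> real"
    and I :: "nat \<Rightarrow> 'i set" and b :: "nat \<Rightarrow> 'i \<Rightarrow> real"
  assumes prob: "\<And>n. prob_space (M n)" and fin: "\<And>n. finite (I n)"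
    and ind: "\<And>n. prob_space.indep_vars (M n) (\<lambda>_. borel) (Z n) (I n)"
    and int4: "\<And>n i. i \<in> I n \<Longrightarrow> integrable (M n) (\<lambda>\<omega>. Z n i \<omega> ^ 4)"
    and mean: "\<And>n i. i \<in> I n \<Longrightarrow> (LINT \<omega>|M n. Z n i \<omega>) = 0"
    and second: "\<And>n i. i \<in> I n \<Longrightarrow> (LINT \<omega>|M n. (Z n i \<omega>)\<^sup>2) = 1"
    and fourth: "\<And>n i. i \<in> I n \<Longrightarrow> (LINT \<omega>|M n. Z n i \<omega> ^ 4) \<le> K"
    and unit: "\<And>n. (\<Sum>i\<in>I n. (b n i)\<^sup>2) = 1"
    and small: "\<And>n i. i \<in> I n \<Longrightarrow> \<bar>b n i\<bar> \<le> \<delta> n" and \<delta>: "\<delta> \<longlonglongrightarrow> 0"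
  shows "weak_conv_m (\<lambda>n. distr (M n) borel (\<lambda>\<omega>. \<Sum>i\<in>I n. b n i * Z n i \<omega>)) std_normal_distribution"
proof (rule levy_continuity)
  have rv[measurable]: "Z n i \<in> borel_measurable (M n)" if "i \<in> I n" for n i
    using ind[of n] that unfolding prob_space.indep_vars_def2[OF prob] by auto
  show "real_distribution (distr (M n) borel (\<lambda>\<omega>. \<Sum>i\<in>I n. b n i * Z n i \<omega>))" for n
    by (intro prob_space.real_distribution_distr prob) measurable
  show "real_distribution std_normal_distribution" by (rule real_dist_normal_dist)
  fix t :: real
  let ?\<phi> = "\<lambda>n. char (distr (M n) borel (\<lambda>\<omega>. \<Sum>i\<in>I n. b n i * Z n i \<omega>)) t"
  let ?A = "\<bar>t\<bar> ^ 3 * (1 + K) / 12" and ?B = "t ^ 4 / 8"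
  have K: "0 \<le> K"
  proof -
    from unit[of 0] obtain i where "i \<in> I 0" by fastforce
    from fourth[OF this] show ?thesis
      by (rule order_trans[rotated]) (simp add: integral_nonneg_AE)
  qed
  have bound: "cmod (?\<phi> n - exp (- t\<^sup>2 / 2)) \<le> ?A * \<delta> n + ?B * (\<delta> n)\<^sup>2" for n
  proof -
    interpret prob_space "M n" by (rule prob)
    have "?\<phi> n = (\<Prod>i\<in>I n. char (distr (M n) borel (\<lambda>\<omega>. b n i * Z n i \<omega>)) t)"
      by (intro char_distr_sum indep_vars_compose2[OF ind]) measurable
    moreover have "exp (- t\<^sup>2 / 2) = (\<Prod>i\<in>I n. exp (- (t * b n i)\<^sup>2 / 2))"
      using fin unit by (simp add: exp_sum[symmetric] power_mult_distrib sum_negf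
          flip: sum_divide_distrib sum_distrib_left)
    ultimately have "cmod (?\<phi> n - exp (- t\<^sup>2 / 2))
        = cmod ((\<Prod>i\<in>I n. char (distr (M n) borel (\<lambda>\<omega>. b n i * Z n i \<omega>)) t)
          - (\<Prod>i\<in>I n. complex_of_real (exp (- (t * b n i)\<^sup>2 / 2))))"
      by (simp only: of_real_prod)
    also have "\<dots> \<le> (\<Sum>i\<in>I n. cmod (char (distr (M n) borel (\<lambda>\<omega>. b n i * Z n i \<omega>)) t
          - complex_of_real (exp (- (t * b n i)\<^sup>2 / 2))))"
    proof (rule norm_prod_diff)
      fix i assume "i \<in> I n"
      then interpret X: real_distribution "distr (M n) borel (\<lambda>\<omega>. b n i * Z n i \<omega>)"
        by (intro real_distribution_distr) measurable
      show "cmod (char (distr (M n) borel (\<lambda>\<omega>. b n i * Z n i \<omega>)) t) \<le> 1"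
        by (rule X.cmod_char_le_1)
      show "cmod (complex_of_real (exp (- (t * b n i)\<^sup>2 / 2))) \<le> 1"
        by (subst norm_of_real) simp
    qed
    also have "\<dots> \<le> (\<Sum>i\<in>I n. (?A * \<delta> n + ?B * (\<delta> n)\<^sup>2) * (b n i)\<^sup>2)"
    proof (rule sum_mono)
      fix i assume i: "i \<in> I n"
      have sq: "(b n i)\<^sup>2 \<le> (\<delta> n)\<^sup>2"
        using small[OF i] by (rule abs_le_square_iff[THEN iffD1, OF order_trans]) simp
      have "cmod (char (distr (M n) borel (\<lambda>\<omega>. b n i * Z n i \<omega>)) t - exp (- (t * b n i)\<^sup>2 / 2))
          \<le> \<bar>t * b n i\<bar> ^ 3 * (1 + K) / 12 + (t * b n i) ^ 4 / 8"
        using i by (intro char_scaled_approx_gaussian rv int4 mean second fourth)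
      also have "\<dots> = ?A * \<bar>b n i\<bar> * (b n i)\<^sup>2 + ?B * (b n i)\<^sup>2 * (b n i)\<^sup>2"
      proof -
        have cube: "\<bar>b n i\<bar> ^ 3 = \<bar>b n i\<bar> * (b n i)\<^sup>2"
          by (simp add: power3_eq_cube power2_eq_square)
        have fourth_power: "b n i ^ 4 = (b n i)\<^sup>2 * (b n i)\<^sup>2"
          by (simp add: power4_eq_xxxx power2_eq_square)
        have "x * (y * z) * k / 12 + u * (v * v) / 8 = x * k / 12 * y * z + u / 8 * v * v"
          for x y z k u v :: real by (simp add: algebra_simps)
        then show ?thesis
          unfolding abs_mult power_mult_distrib cube fourth_power by blast
      qed
      also have "\<dots> \<le> ?A * \<delta> n * (b n i)\<^sup>2 + ?B * (\<delta> n)\<^sup>2 * (b n i)\<^sup>2"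
        using small[OF i] sq K by (intro add_mono mult_right_mono mult_left_mono) auto
      finally show "cmod (char (distr (M n) borel (\<lambda>\<omega>. b n i * Z n i \<omega>)) t
          - complex_of_real (exp (- (t * b n i)\<^sup>2 / 2))) \<le> (?A * \<delta> n + ?B * (\<delta> n)\<^sup>2) * (b n i)\<^sup>2"
        by (simp add: distrib_right)
    qed
    also have "\<dots> = ?A * \<delta> n + ?B * (\<delta> n)\<^sup>2"
      by (simp only: sum_distrib_left[symmetric] unit mult_1_right)
    finally show ?thesis .
  qed
  have "(\<lambda>n. ?A * \<delta> n + ?B * (\<delta> n)\<^sup>2) \<longlonglongrightarrow> ?A * 0 + ?B * 0\<^sup>2"
    by (intro tendsto_intros \<delta>)
  then have "(\<lambda>n. ?A * \<delta> n + ?B * (\<delta> n)\<^sup>2) \<longlonglongrightarrow> 0" by simp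
  from Lim_null_comparison[OF always_eventually[OF allI[OF bound]] this]
  have "(\<lambda>n. ?\<phi> n - exp (- t\<^sup>2 / 2)) \<longlonglongrightarrow> 0" .
  then show "?\<phi> \<longlonglongrightarrow> char std_normal_distribution t"
    unfolding char_std_normal_distribution by (rule LIM_zero_cancel)
qed

section \<open>Self-normalized sums\<close>

lemma isCont_cdf_std_normal: "isCont (cdf std_normal_distribution) x"
proof -
  interpret real_distribution std_normal_distribution by (rule real_dist_normal_dist)
  have "emeasure std_normal_distribution {x} = 0"
    by (subst emeasure_density) (auto simp: nn_integral_null_set null_setsI)
  then show ?thesis by (simp add: isCont_cdf measure_def)
qed

text \<open>
  Slutsky's theorem for a random normalization. On the event \<open>|R - 1| < \<delta>\<close> with \<open>\<delta> < 1\<close>, the inequality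
  \<open>T / sqrt R \<le> x\<close> reads \<open>T \<le> x sqrt R\<close>, and \<open>x sqrt R\<close> lies within \<open>|x| \<delta>\<close> of \<open>x\<close>. The distribution
  function of the ratio at \<open>x\<close> is therefore squeezed between values of that of \<open>T\<close> at nearby points,
  up to the vanishing probability of the complement. The points where \<open>R\<close> is not positive, and
  \<open>U\<close> is arbitrary, lie in this complement.
\<close>

lemma weak_conv_self_normalized:
  fixes M :: "nat \<Rightarrow> 'a measure" and T R U :: "nat \<Rightarrow> 'a \<Rightarrow> real"
  assumes prob: "\<And>n. prob_space (M n)"
    and T[measurable]: "\<And>n. T n \<in> borel_measurable (M n)"
    and R[measurable]: "\<And>n. R n \<in> borel_measurable (M n)"
    and U[measurable]: "\<And>n. U n \<in> borel_measurable (M n)"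
    and U_eq: "\<And>n \<omega>. \<omega> \<in> space (M n) \<Longrightarrow> R n \<omega> > 0 \<Longrightarrow> U n \<omega> = T n \<omega> / sqrt (R n \<omega>)"
    and T_conv: "weak_conv_m (\<lambda>n. distr (M n) borel (T n)) \<mu>"
    and cont: "\<And>x. isCont (cdf \<mu>) x"
    and R_conv: "\<And>\<delta>. \<delta> > 0 \<Longrightarrow> (\<lambda>n. measure (M n) {\<omega> \<in> space (M n). \<delta> \<le> \<bar>R n \<omega> - 1\<bar>}) \<longlonglongrightarrow> 0"
  shows "weak_conv_m (\<lambda>n. distr (M n) borel (U n)) \<mu>"
  unfolding weak_conv_m_def weak_conv_def
proof (intro allI impI)
  fix x
  let ?F = "cdf \<mu>"
  define G where "G n y = measure (M n) {\<omega> \<in> space (M n). T n \<omega> \<le> y}" for n y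
  define V where "V n = measure (M n) {\<omega> \<in> space (M n). U n \<omega> \<le> x}" for n
  define B where "B \<delta> n = measure (M n) {\<omega> \<in> space (M n). \<delta> \<le> \<bar>R n \<omega> - 1\<bar>}" for \<delta> n
  have cdf_eq: "cdf (distr (M n) borel f) y = measure (M n) {\<omega> \<in> space (M n). f \<omega> \<le> y}"
    if [measurable]: "f \<in> borel_measurable (M n)" for n f y
    unfolding cdf_def by (subst measure_distr) (auto intro!: arg_cong[where f = "measure (M n)"])
  have G: "(\<lambda>n. G n y) \<longlonglongrightarrow> ?F y" for y
    using T_conv cont unfolding weak_conv_m_def weak_conv_def G_def by (simp add: cdf_eq)
  have sandwich: "G n (x - \<bar>x\<bar> * \<delta>) - B \<delta> n \<le> V n \<and> V n \<le> G n (x + \<bar>x\<bar> * \<delta>) + B \<delta> n"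
    if \<delta>: "0 < \<delta>" "\<delta> < 1" for \<delta> n
  proof -
    interpret prob_space "M n" by (rule prob)
    have good: "(T n \<omega> \<le> x - \<bar>x\<bar> * \<delta> \<longrightarrow> U n \<omega> \<le> x) \<and> (U n \<omega> \<le> x \<longrightarrow> T n \<omega> \<le> x + \<bar>x\<bar> * \<delta>)"
      if \<omega>: "\<omega> \<in> space (M n)" and near: "\<not> \<delta> \<le> \<bar>R n \<omega> - 1\<bar>" for \<omega>
    proof -
      have pos: "0 < R n \<omega>" using near \<delta> by linarith
      define s where "s = sqrt (R n \<omega>)"
      have s: "0 < s" "s\<^sup>2 = R n \<omega>" using pos by (auto simp: s_def)
      \<comment> \<open>\<open>|sqrt R - 1| \<le> |R - 1|\<close>, because \<open>sqrt R + 1 \<ge> 1\<close>.\<close>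
      have "\<bar>s - 1\<bar> * 1 \<le> \<bar>s - 1\<bar> * (s + 1)" using s by (intro mult_left_mono) auto
      also have "\<dots> = \<bar>(s - 1) * (s + 1)\<bar>" using s by (simp add: abs_mult)
      also have "(s - 1) * (s + 1) = R n \<omega> - 1" using s by (simp add: power2_eq_square algebra_simps)
      finally have "\<bar>s - 1\<bar> \<le> \<delta>" using near by simp
      then have "\<bar>x\<bar> * \<bar>s - 1\<bar> \<le> \<bar>x\<bar> * \<delta>" by (intro mult_left_mono) auto
      then have "\<bar>x * s - x\<bar> \<le> \<bar>x\<bar> * \<delta>" by (simp add: algebra_simps flip: abs_mult)
      moreover have "U n \<omega> \<le> x \<longleftrightarrow> T n \<omega> \<le> x * s"
        using U_eq[OF \<omega> pos] s by (simp add: s_def divide_le_eq)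
      ultimately show ?thesis by linarith
    qed
    have "G n (x - \<bar>x\<bar> * \<delta>)
        \<le> prob ({\<omega> \<in> space (M n). U n \<omega> \<le> x} \<union> {\<omega> \<in> space (M n). \<delta> \<le> \<bar>R n \<omega> - 1\<bar>})"
      unfolding G_def using good by (intro finite_measure_mono) auto
    also have "\<dots> \<le> V n + B \<delta> n"
      unfolding V_def B_def by (intro measure_Un_le) measurable
    finally have 1: "G n (x - \<bar>x\<bar> * \<delta>) \<le> V n + B \<delta> n" .
    have "V n \<le> prob ({\<omega> \<in> space (M n). T n \<omega> \<le> x + \<bar>x\<bar> * \<delta>}
        \<union> {\<omega> \<in> space (M n). \<delta> \<le> \<bar>R n \<omega> - 1\<bar>})"
      unfolding V_def using good by (intro finite_measure_mono) auto
    also have "\<dots> \<le> G n (x + \<bar>x\<bar> * \<delta>) + B \<delta> n"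
      unfolding G_def B_def by (intro measure_Un_le) measurable
    finally show ?thesis using 1 by simp
  qed
  have "(\<lambda>n. V n) \<longlonglongrightarrow> ?F x"
  proof (rule LIMSEQ_I)
    fix e :: real assume "0 < e"
    with cont[of x] obtain d where d: "0 < d" "\<And>y. \<bar>y - x\<bar> < d \<Longrightarrow> \<bar>?F y - ?F x\<bar> < e / 3"
      unfolding continuous_at_eps_delta dist_real_def by (metis zero_less_divide_iff zero_less_numeral)
    define \<delta> where "\<delta> = min (1 / 2) (d / (2 * (\<bar>x\<bar> + 1)))"
    have \<delta>: "0 < \<delta>" "\<delta> < 1" using d by (auto simp: \<delta>_def)
    have "\<bar>x\<bar> * \<delta> < d"
    proof -
      have "\<bar>x\<bar> * \<delta> \<le> \<bar>x\<bar> * (d / (2 * (\<bar>x\<bar> + 1)))" by (intro mult_left_mono) (auto simp: \<delta>_def)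
      also have "\<dots> < d" using d by (simp add: field_simps) (smt (verit) mult_nonneg_nonneg)
      finally show ?thesis .
    qed
    then have F: "?F x - e / 3 < ?F (x - \<bar>x\<bar> * \<delta>)" "?F (x + \<bar>x\<bar> * \<delta>) < ?F x + e / 3"
    proof -
      have "\<bar>?F (x - \<bar>x\<bar> * \<delta>) - ?F x\<bar> < e / 3" "\<bar>?F (x + \<bar>x\<bar> * \<delta>) - ?F x\<bar> < e / 3"
        using \<open>\<bar>x\<bar> * \<delta> < d\<close> \<delta> by - (rule d(2), simp add: abs_mult)+
      then show "?F x - e / 3 < ?F (x - \<bar>x\<bar> * \<delta>)" "?F (x + \<bar>x\<bar> * \<delta>) < ?F x + e / 3"
        by (simp_all only: abs_less_iff) linarith+
    qed
    have "\<forall>\<^sub>F n in sequentially. ?F x - e / 3 < G n (x - \<bar>x\<bar> * \<delta>)"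
      using G F(1) by (rule order_tendstoD)
    moreover have "\<forall>\<^sub>F n in sequentially. G n (x + \<bar>x\<bar> * \<delta>) < ?F x + e / 3"
      using G F(2) by (rule order_tendstoD)
    moreover have "\<forall>\<^sub>F n in sequentially. B \<delta> n < e / 3"
      unfolding B_def using \<open>0 < e\<close> by (intro order_tendstoD(2)[OF R_conv] \<delta>) auto
    ultimately have "\<forall>\<^sub>F n in sequentially. norm (V n - ?F x) < e"
    proof eventually_elim
      case (elim n)
      then show ?case using sandwich[OF \<delta>, of n] by (auto simp: abs_less_iff)
    qed
    then show "\<exists>no. \<forall>n\<ge>no. norm (V n - ?F x) < e"
      by (simp add: eventually_sequentially)
  qed
  then show "(\<lambda>n. cdf (distr (M n) borel (U n)) x) \<longlonglongrightarrow> ?F x"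
    by (simp add: cdf_eq V_def)
qed

section \<open>Concentration of the variance estimator\<close>

lemma sum_of_squared_residuals_eq_form:
  fixes q :: "nat \<Rightarrow> nat \<Rightarrow> real"
  assumes sym: "\<And>i j. i < n \<Longrightarrow> j < n \<Longrightarrow> q i j = q j i"
  shows "(\<Sum>k<n. d k * (\<Sum>j<n. q k j * z j)\<^sup>2)
    = (\<Sum>i<n. \<Sum>j<n. (\<Sum>k<n. q i k * d k * q k j) * (z i * z j))"
proof -
  have "(\<Sum>k<n. d k * (\<Sum>j<n. q k j * z j)\<^sup>2)
      = (\<Sum>k<n. \<Sum>i<n. \<Sum>j<n. q k i * d k * q k j * (z i * z j))"
    by (simp add: power2_eq_square sum_product sum_distrib_left mult_ac)
  also have "\<dots> = (\<Sum>i<n. \<Sum>k<n. \<Sum>j<n. q k i * d k * q k j * (z i * z j))"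
    by (rule sum.swap)
  also have "\<dots> = (\<Sum>i<n. \<Sum>j<n. \<Sum>k<n. q k i * d k * q k j * (z i * z j))"
    by (intro sum.cong refl sum.swap)
  also have "\<dots> = (\<Sum>i<n. \<Sum>j<n. (\<Sum>k<n. q i k * d k * q k j) * (z i * z j))"
    unfolding sum_distrib_right by (intro sum.cong refl) (auto simp: sym)
  finally show ?thesis .
qed

text \<open>
  Here \<open>R\<close> is the variance estimate divided by its target \<open>V\<close>, and \<open>m\<close> bounds the share of a single
  term in \<open>V\<close>. As a quadratic form in \<open>Z\<close>, \<open>R\<close> has trace 1, and the squared Frobenius norm of its
  matrix is at most \<open>(C / V)\<^sup>2 \<Sum> d\<^sub>k\<^sup>2 \<le> (C / (c V))\<^sup>2 \<Sum> a\<^sub>k\<^sup>4 \<le> C\<^sup>2 m / c\<^sup>4\<close>. The bound then follows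
  from the second moment by Markov's inequality.
\<close>

lemma (in prob_space) variance_ratio_concentrates:
  fixes q :: "nat \<Rightarrow> nat \<Rightarrow> real" and a d s :: "nat \<Rightarrow> real" and Z :: "nat \<Rightarrow> 'a \<Rightarrow> real"
  assumes sym: "\<And>i j. i < n \<Longrightarrow> j < n \<Longrightarrow> q i j = q j i"
    and idem: "\<And>i j. i < n \<Longrightarrow> j < n \<Longrightarrow> (\<Sum>k<n. q i k * q k j) = q i j"
    and c: "0 < c"
    and coercive: "c * (\<Sum>i<n. (d i)\<^sup>2) \<le> (\<Sum>i<n. \<Sum>j<n. d i * (q i j)\<^sup>2 * d j)"
    and solves: "\<And>i. i < n \<Longrightarrow> (\<Sum>k<n. (q i k)\<^sup>2 * d k) = (a i)\<^sup>2"
    and s: "\<And>i. i < n \<Longrightarrow> c \<le> (s i)\<^sup>2" "\<And>i. i < n \<Longrightarrow> (s i)\<^sup>2 \<le> C"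
    and V: "V = (\<Sum>i<n. (a i * s i)\<^sup>2)" "0 < V"
    and m: "\<And>i. i < n \<Longrightarrow> (a i * s i)\<^sup>2 \<le> m * V"
    and ind: "indep_vars (\<lambda>_. borel) Z {..<n}"
    and int4: "\<And>i. i < n \<Longrightarrow> integrable M (\<lambda>\<omega>. Z i \<omega> ^ 4)"
    and mean: "\<And>i. i < n \<Longrightarrow> expectation (Z i) = 0"
    and second: "\<And>i. i < n \<Longrightarrow> expectation (\<lambda>\<omega>. (Z i \<omega>)\<^sup>2) = 1"
    and fourth: "\<And>i. i < n \<Longrightarrow> expectation (\<lambda>\<omega>. Z i \<omega> ^ 4) \<le> K"
    and \<delta>: "0 < \<delta>"
  defines "R \<equiv> \<lambda>\<omega>. (\<Sum>k<n. d k * (\<Sum>j<n. q k j * (s j * Z j \<omega>))\<^sup>2) / V"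
  shows "prob {\<omega> \<in> space M. \<delta> \<le> \<bar>R \<omega> - 1\<bar>} \<le> 2 * K * (C\<^sup>2 * m / c ^ 4) / \<delta>\<^sup>2"
proof -
  have [measurable]: "Z i \<in> borel_measurable M" if "i < n" for i
    using ind that unfolding indep_vars_def2 by auto
  have [measurable]: "R \<in> borel_measurable M" unfolding R_def by measurable
  have n: "0 < n" using V by (cases n) auto
  have "0 \<le> expectation (\<lambda>\<omega>. Z 0 \<omega> ^ 4)" by (simp add: integral_nonneg_AE)
  then have K: "0 \<le> K" using fourth[OF n] by linarith
  define A where "A i j = (\<Sum>k<n. q i k * d k * q k j)" for i j
  define H where "H i j = A i j * (s i * s j) / V" for i j
  have R_form: "R \<omega> = (\<Sum>i<n. \<Sum>j<n. H i j * (Z i \<omega> * Z j \<omega>))" for \<omega>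
  proof -
    have "(\<Sum>k<n. d k * (\<Sum>j<n. q k j * (s j * Z j \<omega>))\<^sup>2)
        = (\<Sum>i<n. \<Sum>j<n. A i j * (s i * Z i \<omega> * (s j * Z j \<omega>)))"
      unfolding A_def by (rule sum_of_squared_residuals_eq_form[OF sym])
    then show ?thesis unfolding R_def by (simp only:) (simp add: H_def sum_divide_distrib mult_ac)
  qed
  have trace: "(\<Sum>i<n. H i i) = 1"
  proof -
    have "A i i = (a i)\<^sup>2" if i: "i < n" for i
    proof -
      have "A i i = (\<Sum>k<n. (q i k)\<^sup>2 * d k)"
        unfolding A_def using i by (intro sum.cong) (auto simp: power2_eq_square sym[of _ i])
      then show ?thesis using solves i by simp
    qed
    then have "(\<Sum>i<n. H i i) = (\<Sum>i<n. (a i * s i)\<^sup>2) / V"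
      by (simp add: H_def power2_eq_square sum_divide_distrib mult_ac)
    then show ?thesis using V by simp
  qed
  have fourth_powers: "c\<^sup>2 * (\<Sum>i<n. ((a i)\<^sup>2)\<^sup>2) \<le> m * V\<^sup>2"
  proof -
    have "c\<^sup>2 * (\<Sum>i<n. ((a i)\<^sup>2)\<^sup>2) = (\<Sum>i<n. ((a i)\<^sup>2 * c)\<^sup>2)"
      by (simp add: power_mult_distrib sum_distrib_left mult.commute)
    also have "\<dots> \<le> (\<Sum>i<n. (m * V) * (a i * s i)\<^sup>2)"
    proof (rule sum_mono)
      fix i assume "i \<in> {..<n}"
      then have i: "i < n" by simp
      have "(a i)\<^sup>2 * c \<le> (a i * s i)\<^sup>2"
        using s(1)[OF i] by (simp add: power_mult_distrib mult_left_mono)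
      then have "((a i)\<^sup>2 * c)\<^sup>2 \<le> (a i * s i)\<^sup>2 * (a i * s i)\<^sup>2"
        using c unfolding power2_eq_square[of "_ * c"] by (intro mult_mono) auto
      also have "\<dots> \<le> (m * V) * (a i * s i)\<^sup>2" using m[OF i] by (intro mult_right_mono) auto
      finally show "((a i)\<^sup>2 * c)\<^sup>2 \<le> (m * V) * (a i * s i)\<^sup>2" .
    qed
    also have "\<dots> = m * V\<^sup>2" by (simp add: V(1) power2_eq_square flip: sum_distrib_left)
    finally show ?thesis .
  qed
  have "c ^ 4 * (\<Sum>i<n. (d i)\<^sup>2) = c\<^sup>2 * (c\<^sup>2 * (\<Sum>i<n. (d i)\<^sup>2))" by simp
  also have "\<dots> \<le> c\<^sup>2 * (\<Sum>i<n. ((a i)\<^sup>2)\<^sup>2)"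
    using solution_norm_le[OF c coercive solves] by (intro mult_left_mono) auto
  also note fourth_powers
  finally have d_norm: "(\<Sum>i<n. (d i)\<^sup>2) \<le> m * V\<^sup>2 / c ^ 4"
    using c by (simp add: pos_le_divide_eq mult.commute)
  have "(\<Sum>i<n. \<Sum>j<n. (H i j)\<^sup>2) \<le> (\<Sum>i<n. \<Sum>j<n. C\<^sup>2 / V\<^sup>2 * (A i j)\<^sup>2)"
  proof (intro sum_mono)
    fix i j assume "i \<in> {..<n}" "j \<in> {..<n}"
    then have "(s i)\<^sup>2 * (s j)\<^sup>2 \<le> C * C"
      using s c by (intro mult_mono) (auto intro: order_trans[OF zero_le_power2])
    then have "(A i j)\<^sup>2 * ((s i)\<^sup>2 * (s j)\<^sup>2) / V\<^sup>2 \<le> (A i j)\<^sup>2 * (C * C) / V\<^sup>2"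
      by (intro divide_right_mono mult_left_mono) auto
    then show "(H i j)\<^sup>2 \<le> C\<^sup>2 / V\<^sup>2 * (A i j)\<^sup>2"
      by (simp add: H_def power_mult_distrib power_divide power2_eq_square[of C] mult.commute)
  qed
  also have "\<dots> = C\<^sup>2 / V\<^sup>2 * (\<Sum>i<n. \<Sum>j<n. (A i j)\<^sup>2)" by (simp add: sum_distrib_left)
  also have "\<dots> \<le> C\<^sup>2 / V\<^sup>2 * (\<Sum>i<n. (d i)\<^sup>2)"
    unfolding A_def using projection_sandwich_frobenius_le[OF sym idem] by (intro mult_left_mono) auto
  also have "\<dots> \<le> C\<^sup>2 / V\<^sup>2 * (m * V\<^sup>2 / c ^ 4)" using d_norm by (intro mult_left_mono) auto
  also have "\<dots> = C\<^sup>2 * m / c ^ 4" using V by simp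
  finally have H_norm: "(\<Sum>i<n. \<Sum>j<n. (H i j)\<^sup>2) \<le> C\<^sup>2 * m / c ^ 4" .
  have int: "integrable M (\<lambda>\<omega>. (R \<omega> - 1)\<^sup>2)"
    and "expectation (\<lambda>\<omega>. (R \<omega> - 1)\<^sup>2) \<le> 2 * K * (\<Sum>i<n. \<Sum>j<n. (H i j)\<^sup>2)"
    using second_moment_quadratic_form[OF finite_lessThan ind, of K H] int4 mean second fourth
    unfolding R_form trace by auto
  note this(2)
  also have "2 * K * (\<Sum>i<n. \<Sum>j<n. (H i j)\<^sup>2) \<le> 2 * K * (C\<^sup>2 * m / c ^ 4)"
    using H_norm K by (intro mult_left_mono) auto
  finally have L2: "expectation (\<lambda>\<omega>. (R \<omega> - 1)\<^sup>2) \<le> 2 * K * (C\<^sup>2 * m / c ^ 4)" .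
  have "prob {\<omega> \<in> space M. \<delta> \<le> \<bar>R \<omega> - 1\<bar>} = prob {\<omega> \<in> space M. \<delta>\<^sup>2 \<le> (R \<omega> - 1)\<^sup>2}"
    using \<delta> by (simp add: abs_le_square_iff[symmetric])
  also have "\<dots> \<le> expectation (\<lambda>\<omega>. (R \<omega> - 1)\<^sup>2) / \<delta>\<^sup>2"
    using int \<delta> by (intro integral_Markov_inequality_measure[where A = "{}"]) auto
  also have "\<dots> \<le> 2 * K * (C\<^sup>2 * m / c ^ 4) / \<delta>\<^sup>2" using L2 by (intro divide_right_mono) auto
  finally show ?thesis .
qed

section \<open>Asymptotic normality\<close>

lemma weak_conv_m_offset:
  assumes "weak_conv_m (\<lambda>n. \<mu> (n + k)) \<nu>"
  shows "weak_conv_m \<mu> \<nu>"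
  using assms unfolding weak_conv_m_def weak_conv_def by (auto intro: LIMSEQ_offset)

theorem mainTheorem9:
  fixes M :: "nat \<Rightarrow> 'a measure"
    and n0 :: nat
    and p :: "nat \<Rightarrow> nat"
    and X \<Sigma> :: "nat \<Rightarrow> real mat"
    and \<beta> w :: "nat \<Rightarrow> real vec"
    and N Z :: "nat \<Rightarrow> nat \<Rightarrow> 'a \<Rightarrow> real"
    and \<psi> :: "nat \<Rightarrow> nat \<Rightarrow> real \<Rightarrow> real"
    and \<epsilon> Y :: "nat \<Rightarrow> 'a \<Rightarrow> real vec"
    and C4 c1 c2 c C r :: real
  assumes prob: "\<And>n. n \<ge> n0 \<Longrightarrow> prob_space (M n)"
    (* the linear models *)
    and X_dim: "\<And>n. n \<ge> n0 \<Longrightarrow> X n \<in> carrier_mat n (p n)"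
    and X_inv: "\<And>n. n \<ge> n0 \<Longrightarrow> invertible_mat (transpose_mat (X n) * X n)"
    and \<beta>_dim: "\<And>n. n \<ge> n0 \<Longrightarrow> \<beta> n \<in> carrier_vec (p n)"
    and w_dim: "\<And>n. n \<ge> n0 \<Longrightarrow> w n \<in> carrier_vec (p n)"
    and w_unit: "\<And>n. n \<ge> n0 \<Longrightarrow> sqrt (w n \<bullet> w n) = 1"
    and model: "\<And>n \<omega>. n \<ge> n0 \<Longrightarrow> \<omega> \<in> space (M n) \<Longrightarrow> Y n \<omega> = X n *\<^sub>v \<beta> n + \<epsilon> n \<omega>"
    (* (i) *)
    and \<Sigma>_dim: "\<And>n. n \<ge> n0 \<Longrightarrow> \<Sigma> n \<in> carrier_mat n n"
    and \<Sigma>_diag: "\<And>n. n \<ge> n0 \<Longrightarrow> diagonal_mat (\<Sigma> n)"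
    and noise: "\<And>n \<omega>. n \<ge> n0 \<Longrightarrow> \<omega> \<in> space (M n) \<Longrightarrow>
          \<epsilon> n \<omega> = diag_sqrt (\<Sigma> n) *\<^sub>v Matrix.vec n (\<lambda>i. Z n i \<omega>)"
    and Z_indep: "\<And>n. n \<ge> n0 \<Longrightarrow> prob_space.indep_vars (M n) (\<lambda>_. borel) (Z n) {..<n}"
    and Z_mean: "\<And>n i. n \<ge> n0 \<Longrightarrow> i < n \<Longrightarrow> prob_space.expectation (M n) (Z n i) = 0"
    and Z_var: "\<And>n i. n \<ge> n0 \<Longrightarrow> i < n \<Longrightarrow> prob_space.variance (M n) (Z n i) = 1"
    and Z_int4: "\<And>n i. n \<ge> n0 \<Longrightarrow> i < n \<Longrightarrow> integrable (M n) (\<lambda>\<omega>. Z n i \<omega> ^ 4)"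
    and Z_mom4: "\<And>n i. n \<ge> n0 \<Longrightarrow> i < n \<Longrightarrow>
          prob_space.expectation (M n) (\<lambda>\<omega>. Z n i \<omega> ^ 4) \<le> C4"
    and N_meas: "\<And>n i. n \<ge> n0 \<Longrightarrow> i < n \<Longrightarrow> N n i \<in> borel_measurable (M n)"
    and N_normal: "\<And>n. n \<ge> n0 \<Longrightarrow>
          distr (M n) (\<Pi>\<^sub>M i\<in>{..<n}. borel) (\<lambda>\<omega>. \<lambda>i\<in>{..<n}. N n i \<omega>)
            = std_normal_vec_distribution n"
    and Z_eq: "\<And>n i \<omega>. n \<ge> n0 \<Longrightarrow> i < n \<Longrightarrow> \<omega> \<in> space (M n) \<Longrightarrow> Z n i \<omega> = \<psi> n i (N n i \<omega>)"
    and \<psi>_diff: "\<And>n i. n \<ge> n0 \<Longrightarrow> i < n \<Longrightarrow> twice_differentiable (\<psi> n i)"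
    and consts_i: "c1 > 0" "c2 > 0"
    and \<psi>_deriv1: "\<And>n i. n \<ge> n0 \<Longrightarrow> i < n \<Longrightarrow> sup_norm (deriv (\<psi> n i)) < ereal c1"
    and \<psi>_deriv2: "\<And>n i. n \<ge> n0 \<Longrightarrow> i < n \<Longrightarrow> sup_norm (deriv (deriv (\<psi> n i))) < ereal c2"
    (* (ii) *)
    and consts_ii: "c > 0" "C > 0"
    and QQ_min: "\<And>n. n \<ge> n0 \<Longrightarrow> lambda_min (resid_mat (X n) \<odot>\<^sub>m resid_mat (X n)) > c"
    and S_small: "(\<lambda>n. Max ((\<lambda>j. \<bar>w n \<bullet> col (ols_mat (X n)) j\<bar>) ` {..<n}))
          \<in> o(\<lambda>n. real n powr (-1/4) * lambda_min (transpose_mat (X n) * X n) powr (-1/2))"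
    and \<Sigma>_min: "\<And>n. n \<ge> n0 \<Longrightarrow> c < lambda_min (\<Sigma> n)"
    and \<Sigma>_le: "\<And>n. n \<ge> n0 \<Longrightarrow> lambda_min (\<Sigma> n) \<le> lambda_max (\<Sigma> n)"
    and \<Sigma>_max: "\<And>n. n \<ge> n0 \<Longrightarrow> lambda_max (\<Sigma> n) < C"
    (* (iii) *)
    and lindeberg: "(\<lambda>n.
          Max ((\<lambda>j. \<bar>w n \<bullet> (ols_mat (X n) * diag_sqrt (\<Sigma> n) *\<^sub>v unit_vec n j)\<bar>\<^sup>2) ` {..<n})
          / (w n \<bullet> (ols_mat (X n) * \<Sigma> n * transpose_mat (ols_mat (X n)) *\<^sub>v w n)))
        \<longlonglongrightarrow> 0"
  shows "weak_conv_m (\<lambda>n. distr (M n) borel (\<lambda>\<omega>. studentized r (X n) (\<beta> n) (w n) (Y n \<omega>)))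
           std_normal_distribution"
proof -
  define D where "D n = diag_sqrt (\<Sigma> n)" for n
  define a where "a n j = w n \<bullet> col (ols_mat (X n)) j" for n j
  define q where "q n i j = resid_mat (X n) $$ (i, j)" for n i j
  define s where "s n j = sqrt (\<Sigma> n $$ (j, j))" for n j
  define V where "V n = (\<Sum>j<n. (a n j * s n j)\<^sup>2)" for n
  define m where "m n = Max ((\<lambda>j. \<bar>w n \<bullet> (ols_mat (X n) * diag_sqrt (\<Sigma> n) *\<^sub>v unit_vec n j)\<bar>\<^sup>2) ` {..<n})
          / (w n \<bullet> (ols_mat (X n) * \<Sigma> n * transpose_mat (ols_mat (X n)) *\<^sub>v w n))" for n
  have m_lim: "m \<longlonglongrightarrow> 0" using lindeberg by (simp add: m_def[abs_def])
  have \<Sigma>_entry: "c \<le> \<Sigma> n $$ (j, j)" "\<Sigma> n $$ (j, j) \<le> C" if n: "n0 \<le> n" and j: "j < n" for n j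
  proof -
    have "\<Sigma> n $$ (j, j) \<in> spectrum (\<Sigma> n)"
      by (rule diagonal_entry_in_spectrum[OF \<Sigma>_dim[OF n] \<Sigma>_diag[OF n] j])
    with card_finite_spectrum(1)[OF \<Sigma>_dim[OF n]]
    have "lambda_min (\<Sigma> n) \<le> \<Sigma> n $$ (j, j)" "\<Sigma> n $$ (j, j) \<le> lambda_max (\<Sigma> n)"
      unfolding lambda_min_def lambda_max_def by auto
    then show "c \<le> \<Sigma> n $$ (j, j)" "\<Sigma> n $$ (j, j) \<le> C"
      using \<Sigma>_min[OF n] \<Sigma>_max[OF n] by auto
  qed
  have s2: "(s n j)\<^sup>2 = \<Sigma> n $$ (j, j)" if "n0 \<le> n" "j < n" for n j
    using \<Sigma>_entry(1)[OF that] consts_ii by (simp add: s_def)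
  have D: "D n \<in> carrier_mat n n" "diagonal_mat (D n)" if n: "n0 \<le> n" for n
    using \<Sigma>_dim[OF n] \<Sigma>_diag[OF n] by (auto simp: D_def diag_sqrt_def diagonal_mat_def)
  have D_entry: "D n $$ (j, j) = s n j" if "n0 \<le> n" "j < n" for n j
    using \<Sigma>_dim[OF that(1)] that(2) by (simp add: D_def diag_sqrt_def s_def)
  have S: "ols_mat (X n) \<in> carrier_mat (p n) n" if n: "n0 \<le> n" for n
    by (rule least_squares_matrices(1)[OF X_dim[OF n] X_inv[OF n]])
  have V_eq: "w n \<bullet> (ols_mat (X n) * \<Sigma> n * transpose_mat (ols_mat (X n)) *\<^sub>v w n) = V n"
    if n: "n0 \<le> n" for n
    unfolding scalar_prod_sandwich_diagonal[OF S[OF n] w_dim[OF n] \<Sigma>_dim[OF n] \<Sigma>_diag[OF n]] V_def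
    using s2[OF n] by (simp add: a_def power_mult_distrib)
  have V_pos: "0 < V n" if n: "n0 \<le> n" for n
  proof -
    have "w n \<bullet> w n \<noteq> 0" using w_unit[OF n] by auto
    then have "0 < c * (\<Sum>j<n. (a n j)\<^sup>2)"
      unfolding a_def using ols_weights_nonzero[OF X_dim[OF n] X_inv[OF n] w_dim[OF n]] consts_ii by simp
    also have "\<dots> = (\<Sum>j<n. (a n j)\<^sup>2 * c)" by (simp add: sum_distrib_left mult.commute)
    also have "\<dots> \<le> V n"
      unfolding V_def power_mult_distrib using s2[OF n] \<Sigma>_entry(1)[OF n]
      by (intro sum_mono mult_left_mono) auto
    finally show ?thesis .
  qed
  have m_bound: "(a n j * s n j)\<^sup>2 \<le> m n * V n" if n: "n0 \<le> n" and j: "j < n" for n j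
  proof -
    have entry: "w n \<bullet> (ols_mat (X n) * diag_sqrt (\<Sigma> n) *\<^sub>v unit_vec n j) = a n j * s n j" if "j < n" for j
      using scalar_prod_diagonal_unit[OF S[OF n] w_dim[OF n] D[OF n] that]
      by (simp add: a_def D_entry[OF n that] flip: D_def)
    have "m n * V n = Max ((\<lambda>j. \<bar>w n \<bullet> (ols_mat (X n) * diag_sqrt (\<Sigma> n) *\<^sub>v unit_vec n j)\<bar>\<^sup>2) ` {..<n})"
      unfolding m_def V_eq[OF n] using V_pos[OF n] by simp
    moreover have "\<bar>w n \<bullet> (ols_mat (X n) * diag_sqrt (\<Sigma> n) *\<^sub>v unit_vec n j)\<bar>\<^sup>2 \<le> \<dots>"
      using j by (intro Max_ge) auto
    ultimately show ?thesis using entry[OF j] by simp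
  qed
  have \<epsilon>: "\<epsilon> n \<omega> \<in> carrier_vec n" "\<And>j. j < n \<Longrightarrow> \<epsilon> n \<omega> $ j = s n j * Z n j \<omega>"
    if n: "n0 \<le> n" and \<omega>: "\<omega> \<in> space (M n)" for n \<omega>
  proof -
    have eq: "\<epsilon> n \<omega> = D n *\<^sub>v vec n (\<lambda>i. Z n i \<omega>)" using noise[OF n \<omega>] by (simp add: D_def)
    show "\<epsilon> n \<omega> \<in> carrier_vec n" unfolding eq using D(1)[OF n] by simp
    show "\<epsilon> n \<omega> $ j = s n j * Z n j \<omega>" if "j < n" for j
      unfolding eq using diagonal_mult_vec[OF D[OF n] _ that, of "vec n (\<lambda>i. Z n i \<omega>)"] that
      by (simp add: D_entry[OF n])
  qed
  have QQ: "0 < lambda_min (resid_mat (X n) \<odot>\<^sub>m resid_mat (X n))" if "n0 \<le> n" for n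
    using QQ_min[OF that] consts_ii by simp
  define good where "good n d \<longleftrightarrow> (\<forall>i<n. (\<Sum>k<n. (q n i k)\<^sup>2 * d k) = (a n i)\<^sup>2) \<and>
      (\<forall>\<omega>\<in>space (M n). var_hat (X n) (w n) (Y n \<omega>)
        = (\<Sum>k<n. d k * (\<Sum>j<n. q n k j * (s n j * Z n j \<omega>))\<^sup>2))" for n d
  have good_ex: "\<exists>d. good n d" if n: "n0 \<le> n" "0 < n" for n
  proof -
    obtain d where d: "\<And>i. i < n \<Longrightarrow> (\<Sum>k<n. (resid_mat (X n) $$ (i, k))\<^sup>2 * d k) = (w n \<bullet> col (ols_mat (X n)) i)\<^sup>2"
      "\<And>\<beta> \<epsilon>. \<beta> \<in> carrier_vec (p n) \<Longrightarrow> \<epsilon> \<in> carrier_vec n \<Longrightarrow>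
      var_hat (X n) (w n) (X n *\<^sub>v \<beta> + \<epsilon>) = (\<Sum>k<n. d k * (\<Sum>j<n. resid_mat (X n) $$ (k, j) * \<epsilon> $ j)\<^sup>2)"
      by (rule var_hat_quadratic_form[OF X_dim[OF n(1)] X_inv[OF n(1)] w_dim[OF n(1)] n(2) QQ[OF n(1)]]) blast
    have "good n d"
      unfolding good_def
    proof (intro conjI allI impI ballI)
      show "(\<Sum>k<n. (q n i k)\<^sup>2 * d k) = (a n i)\<^sup>2" if "i < n" for i
        unfolding q_def a_def using that by (rule d(1))
      fix \<omega> assume \<omega>: "\<omega> \<in> space (M n)"
      have "var_hat (X n) (w n) (Y n \<omega>) = (\<Sum>k<n. d k * (\<Sum>j<n. q n k j * \<epsilon> n \<omega> $ j)\<^sup>2)"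
        unfolding model[OF n(1) \<omega>] q_def by (rule d(2)[OF \<beta>_dim[OF n(1)] \<epsilon>(1)[OF n(1) \<omega>]])
      then show "var_hat (X n) (w n) (Y n \<omega>) = (\<Sum>k<n. d k * (\<Sum>j<n. q n k j * (s n j * Z n j \<omega>))\<^sup>2)"
        using \<epsilon>(2)[OF n(1) \<omega>] by simp
    qed
    then show ?thesis by blast
  qed
  define d where "d n = (SOME d. good n d)" for n
  have good: "good n (d n)" if "n0 \<le> n" "0 < n" for n
    unfolding d_def using good_ex[OF that] by (rule someI_ex)
  have solves: "(\<Sum>k<n. (q n i k)\<^sup>2 * d n k) = (a n i)\<^sup>2" if "n0 \<le> n" "i < n" for n i
    using good[of n] that by (simp add: good_def)
  have var_hat_eq: "var_hat (X n) (w n) (Y n \<omega>)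
      = (\<Sum>k<n. d n k * (\<Sum>j<n. q n k j * (s n j * Z n j \<omega>))\<^sup>2)"
    if "n0 \<le> n" "0 < n" "\<omega> \<in> space (M n)" for n \<omega>
    using good[OF that(1,2)] that(3) by (simp add: good_def)
  define T where "T n \<omega> = (\<Sum>j<n. (a n j * s n j / sqrt (V n)) * Z n j \<omega>)" for n \<omega>
  define R where "R n \<omega> = (\<Sum>k<n. d n k * (\<Sum>j<n. q n k j * (s n j * Z n j \<omega>))\<^sup>2) / V n" for n \<omega>
  define U where "U n \<omega> = studentized r (X n) (\<beta> n) (w n) (Y n \<omega>)" for n \<omega>
  have U_eq: "U n \<omega> = (if R n \<omega> > 0 then T n \<omega> / sqrt (R n \<omega>) else r)"
    if n: "n0 \<le> n" "0 < n" and \<omega>: "\<omega> \<in> space (M n)" for n \<omega>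
  proof -
    have var: "var_hat (X n) (w n) (Y n \<omega>) = V n * R n \<omega>"
      using var_hat_eq[OF n \<omega>] V_pos[OF n(1)] by (simp add: R_def)
    have "w n \<bullet> beta_hat (X n) (Y n \<omega>) - w n \<bullet> \<beta> n = (\<Sum>j<n. a n j * \<epsilon> n \<omega> $ j)"
      unfolding model[OF n(1) \<omega>] a_def
      by (rule estimation_error_model[OF X_dim[OF n(1)] X_inv[OF n(1)] w_dim[OF n(1)]
            \<beta>_dim[OF n(1)] \<epsilon>(1)[OF n(1) \<omega>]])
    also have "\<dots> = sqrt (V n) * T n \<omega>"
      using V_pos[OF n(1)] \<epsilon>(2)[OF n(1) \<omega>] by (simp add: T_def sum_distrib_left mult.assoc)
    finally show ?thesis
      using V_pos[OF n(1)] by (simp add: U_def studentized_def var zero_less_mult_iff real_sqrt_mult)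
  qed
  have rv: "Z n i \<in> borel_measurable (M n)" if "n0 \<le> n" "i < n" for n i
    using Z_indep[OF that(1)] that(2) unfolding prob_space.indep_vars_def2[OF prob[OF that(1)]] by auto
  have second: "(LINT \<omega>|M n. (Z n i \<omega>)\<^sup>2) = 1" if "n0 \<le> n" "i < n" for n i
    using Z_var[OF that] Z_mean[OF that] by simp
  \<comment> \<open>The hypotheses hold from \<open>n0\<close> on, and the eigenvalue bounds need a positive dimension.\<close>
  let ?k = "Suc n0"
  have T_conv: "weak_conv_m (\<lambda>n. distr (M (n + ?k)) borel (T (n + ?k))) std_normal_distribution"
    unfolding T_def
  proof (rule triangular_array_clt[where K = C4])
    fix n
    let ?n = "n + ?k"
    have n: "n0 \<le> ?n" by simp
    show "prob_space (M ?n)" by (rule prob[OF n])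
    show "prob_space.indep_vars (M ?n) (\<lambda>_. borel) (Z ?n) {..<?n}" by (rule Z_indep[OF n])
    show "(\<Sum>j<?n. (a ?n j * s ?n j / sqrt (V ?n))\<^sup>2) = 1"
      using V_pos[OF n] by (simp add: power_divide flip: sum_divide_distrib V_def)
    fix i assume "i \<in> {..<?n}"
    then have i: "i < ?n" by simp
    show "integrable (M ?n) (\<lambda>\<omega>. Z ?n i \<omega> ^ 4)" by (rule Z_int4[OF n i])
    show "(LINT \<omega>|M ?n. Z ?n i \<omega>) = 0" by (rule Z_mean[OF n i])
    show "(LINT \<omega>|M ?n. (Z ?n i \<omega>)\<^sup>2) = 1" by (rule second[OF n i])
    show "(LINT \<omega>|M ?n. Z ?n i \<omega> ^ 4) \<le> C4" by (rule Z_mom4[OF n i])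
    have "\<bar>a ?n i * s ?n i\<bar> \<le> sqrt (m ?n * V ?n)"
      using m_bound[OF n i] by (rule real_le_rsqrt[OF order_trans[OF eq_refl[OF power2_abs]]])
    then show "\<bar>a ?n i * s ?n i / sqrt (V ?n)\<bar> \<le> sqrt (m ?n)"
      using V_pos[OF n] by (simp add: real_sqrt_mult divide_le_eq)
  next
    have "(\<lambda>n. sqrt (m (n + ?k))) \<longlonglongrightarrow> sqrt 0"
      by (intro tendsto_real_sqrt LIMSEQ_ignore_initial_segment m_lim)
    then show "(\<lambda>n. sqrt (m (n + ?k))) \<longlonglongrightarrow> 0" by simp
  qed simp
  have R_conv: "(\<lambda>n. measure (M (n + ?k)) {\<omega> \<in> space (M (n + ?k)). \<delta> \<le> \<bar>R (n + ?k) \<omega> - 1\<bar>}) \<longlonglongrightarrow> 0"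
    if \<delta>: "0 < \<delta>" for \<delta>
  proof (rule Lim_null_comparison)
    have "(\<lambda>n. 2 * C4 * (C\<^sup>2 * m (n + ?k) / c ^ 4) / \<delta>\<^sup>2) \<longlonglongrightarrow> 2 * C4 * (C\<^sup>2 * 0 / c ^ 4) / \<delta>\<^sup>2"
      using consts_ii \<delta> by (intro tendsto_intros LIMSEQ_ignore_initial_segment m_lim) auto
    then show "(\<lambda>n. 2 * C4 * (C\<^sup>2 * m (n + ?k) / c ^ 4) / \<delta>\<^sup>2) \<longlonglongrightarrow> 0" by simp
    show "\<forall>\<^sub>F n in sequentially. norm (measure (M (n + ?k)) {\<omega> \<in> space (M (n + ?k)). \<delta> \<le> \<bar>R (n + ?k) \<omega> - 1\<bar>})
        \<le> 2 * C4 * (C\<^sup>2 * m (n + ?k) / c ^ 4) / \<delta>\<^sup>2"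
    proof (rule always_eventually, rule allI)
      fix n
      let ?n = "n + ?k"
      have n: "n0 \<le> ?n" "0 < ?n" by simp_all
      interpret prob_space "M ?n" by (rule prob[OF n(1)])
      have "prob {\<omega> \<in> space (M ?n). \<delta> \<le> \<bar>R ?n \<omega> - 1\<bar>} \<le> 2 * C4 * (C\<^sup>2 * m ?n / c ^ 4) / \<delta>\<^sup>2"
        unfolding R_def
      proof (rule variance_ratio_concentrates)
        fix i j assume ij: "i < ?n" "j < ?n"
        show "q ?n i j = q ?n j i" "(\<Sum>k<?n. q ?n i k * q ?n k j) = q ?n i j"
          unfolding q_def by (rule resid_projection[OF X_dim[OF n(1)] X_inv[OF n(1)] ij])+
      next
        have "c * (\<Sum>i<?n. (d ?n i)\<^sup>2)
            \<le> lambda_min (resid_mat (X ?n) \<odot>\<^sub>m resid_mat (X ?n)) * (\<Sum>i<?n. (d ?n i)\<^sup>2)"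
          using QQ_min[OF n(1)] by (intro mult_right_mono sum_nonneg) auto
        also have "\<dots> \<le> (\<Sum>i<?n. \<Sum>j<?n. d ?n i * (q ?n i j)\<^sup>2 * d ?n j)"
          unfolding q_def by (rule QQ_coercive[OF X_dim[OF n(1)] X_inv[OF n(1)] n(2)])
        finally show "c * (\<Sum>i<?n. (d ?n i)\<^sup>2) \<le> (\<Sum>i<?n. \<Sum>j<?n. d ?n i * (q ?n i j)\<^sup>2 * d ?n j)" .
      next
        fix i assume i: "i < ?n"
        show "(\<Sum>k<?n. (q ?n i k)\<^sup>2 * d ?n k) = (a ?n i)\<^sup>2" by (rule solves[OF n(1) i])
        show "c \<le> (s ?n i)\<^sup>2" "(s ?n i)\<^sup>2 \<le> C"
          unfolding s2[OF n(1) i] by (rule \<Sigma>_entry[OF n(1) i])+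
        show "(a ?n i * s ?n i)\<^sup>2 \<le> m ?n * V ?n" by (rule m_bound[OF n(1) i])
        show "integrable (M ?n) (\<lambda>\<omega>. Z ?n i \<omega> ^ 4)" by (rule Z_int4[OF n(1) i])
        show "expectation (Z ?n i) = 0" by (rule Z_mean[OF n(1) i])
        show "expectation (\<lambda>\<omega>. (Z ?n i \<omega>)\<^sup>2) = 1" by (rule second[OF n(1) i])
        show "expectation (\<lambda>\<omega>. Z ?n i \<omega> ^ 4) \<le> C4" by (rule Z_mom4[OF n(1) i])
      next
        show "V ?n = (\<Sum>i<?n. (a ?n i * s ?n i)\<^sup>2)" by (rule V_def)
        show "0 < V ?n" by (rule V_pos[OF n(1)])
        show "indep_vars (\<lambda>_. borel) (Z ?n) {..<?n}" by (rule Z_indep[OF n(1)])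
      qed (use consts_ii \<delta> in auto)
      then show "norm (measure (M ?n) {\<omega> \<in> space (M ?n). \<delta> \<le> \<bar>R ?n \<omega> - 1\<bar>})
          \<le> 2 * C4 * (C\<^sup>2 * m ?n / c ^ 4) / \<delta>\<^sup>2" by simp
    qed
  qed
  have conv: "weak_conv_m (\<lambda>n. distr (M (n + ?k)) borel (U (n + ?k))) std_normal_distribution"
  proof (rule weak_conv_self_normalized[OF _ _ _ _ _ T_conv isCont_cdf_std_normal R_conv])
    fix n
    let ?n = "n + ?k"
    have n: "n0 \<le> ?n" "0 < ?n" by simp_all
    note [measurable] = rv[OF n(1)]
    show "prob_space (M ?n)" by (rule prob[OF n(1)])
    show T[measurable]: "T ?n \<in> borel_measurable (M ?n)" unfolding T_def by measurable
    show R[measurable]: "R ?n \<in> borel_measurable (M ?n)" unfolding R_def by measurable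
    have "(\<lambda>\<omega>. if R ?n \<omega> > 0 then T ?n \<omega> / sqrt (R ?n \<omega>) else r) \<in> borel_measurable (M ?n)"
      by measurable
    then show "U ?n \<in> borel_measurable (M ?n)"
      using U_eq[OF n] by (subst measurable_cong) auto
    show "U ?n \<omega> = T ?n \<omega> / sqrt (R ?n \<omega>)" if "\<omega> \<in> space (M ?n)" "0 < R ?n \<omega>" for \<omega>
      using U_eq[OF n that(1)] that(2) by simp
  qed
  show ?thesis
    by (rule weak_conv_m_offset[where k = ?k], fold U_def) (rule conv)
qed

end
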